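(* Let $R$ be a commutative Noetherian ring and let $A=\sigma(R)\langle x_1,\dots,x_n\rangle$ be a bijective skew $PBW$ extension of automorphism type of $R$, with associated system of automorphisms $\Sigma=\{\sigma_1,\dots,\sigma_n\}$ of $R$. Let $I$ be a proper $\Sigma$-invariant ideal of $R$. Then $I$ is a $\Sigma$-prime ideal of $R$ if and only if $IA$ is a prime ideal of $A$. In such case, $IA=AI$ and $IA\cap R=I$.
   Context: Rings are associative with unit; "ideal" means two-sided ideal. Skew $PBW$ extension: let $R\subseteq A$ be rings. $A$ is a skew $PBW$ extension of $R$, written $A=\sigma(R)\langle x_1,\dots,x_n\rangle$, if there are finitely many elements $x_1,\dots,x_n\in A$ such that: (1) $A$ is a free left $R$-module with basis $\{x^{\alpha}=x_1^{\alpha_1}\cdots x_n^{\alpha_n}\mid \alpha\in\mathbb{N}^n\}$ (with $x_1^0\cdots x_n^0=1$); (2) for every $1\le i\le n$ and $r\in R\setminus\{0\}$ there is $c_{i,r}\in R\setminus\{0\}$ with $x_ir-c_{i,r}x_i\in R$; (3) for all $1\le i,j\le n$ there is $c_{i,j}\in R\setminus\{0\}$ with $x_jx_i-c_{i,j}x_ix_j\in R+Rx_1+\cdots+Rx_n$. For such $A$ there are, for each $i$, an injective ring endomorphism $\sigma_i:R\to R$ and a $\sigma_i$-derivation $\delta_i:R\to R$ (additive, $\delta_i(rs)=\sigma_i(r)\delta_i(s)+\delta_i(r)s$) with $x_ir=\sigma_i(r)x_i+\delta_i(r)$ for all $r\in R$. $A$ is bijective if every $\sigma_i$ is bijective and $c_{i,j}$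 is invertible for all $1\le i<j\le n$. $A$ is of automorphism type if $\delta_i=0$ and $\sigma_i$ is bijective for every $i$. Put $\Sigma=\{\sigma_1,\dots,\sigma_n\}$. An ideal $I$ of $R$ is $\Sigma$-invariant if $\sigma_i(I)\subseteq I$ for every $i$. A proper $\Sigma$-invariant ideal $I$ of $R$ is $\Sigma$-prime if whenever a product of two $\Sigma$-invariant ideals of $R$ is contained in $I$, one of these ideals is contained in $I$. *)

theory Defs
  imports "HOL-Algebra.Ring_Divisibility" "HOL-Algebra.Ideal_Product" "HOL-Algebra.Subrings"
begin

text \<open>
  Rings are those of HOL-Algebra (associative with unit); \<open>ideal\<close> is the two-sided notion. A
  subring \<open>R\<close> of \<open>A\<close> is a subset of the carrier, and viewed as a ring of its own it is
  \<open>A\<lparr>carrier := R\<rparr>\<close>.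
\<close>

section \<open>Skew PBW extensions\<close>

text \<open>The exponents \<open>\<alpha> = (\<alpha>\<^sub>1, \<dots>, \<alpha>\<^sub>n)\<close>, as functions vanishing outside \<open>{1..n}\<close>.\<close>

definition exponents :: "nat \<Rightarrow> (nat \<Rightarrow> nat) set"
  where "exponents n = {\<alpha>. \<forall>i. i \<notin> {1..n} \<longrightarrow> \<alpha> i = 0}"

text \<open>
  The monomial \<open>x\<^sub>1\<^bsup>\<alpha>\<^sub>1\<^esup> \<cdots> x\<^sub>n\<^bsup>\<alpha>\<^sub>n\<^esup>\<close>. The order of the factors matters, so \<open>finprod\<close> does not apply.
\<close>

primrec pbw_monom :: "('a, 'b) ring_scheme \<Rightarrow> (nat \<Rightarrow> 'a) \<Rightarrow> (nat \<Rightarrow> nat) \<Rightarrow> nat \<Rightarrow> 'a"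
  where
    "pbw_monom A x \<alpha> 0 = \<one>\<^bsub>A\<^esub>"
  | "pbw_monom A x \<alpha> (Suc k) = pbw_monom A x \<alpha> k \<otimes>\<^bsub>A\<^esub> (x (Suc k) [^]\<^bsub>A\<^esub> \<alpha> (Suc k))"

text \<open>
  The family \<open>b\<close> over \<open>B\<close> is a basis of the left \<open>R\<close>-module \<open>A\<close>; the coefficient ring is not
  assumed commutative, so the library's \<open>module\<close> is not applicable.
\<close>

definition left_basis :: "('a, 'b) ring_scheme \<Rightarrow> 'a set \<Rightarrow> 'i set \<Rightarrow> ('i \<Rightarrow> 'a) \<Rightarrow> bool"
  where "left_basis A R B b \<longleftrightarrow>
    b \<in> B \<rightarrow> carrier A \<and>
    (\<forall>a\<in>carrier A. \<exists>F c. finite F \<and> F \<subseteq> B \<and> c \<in> F \<rightarrow> R \<and>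
        a = (\<Oplus>\<^bsub>A\<^esub>i\<in>F. c i \<otimes>\<^bsub>A\<^esub> b i)) \<and>
    (\<forall>F c. finite F \<and> F \<subseteq> B \<and> c \<in> F \<rightarrow> R \<and>
        (\<Oplus>\<^bsub>A\<^esub>i\<in>F. c i \<otimes>\<^bsub>A\<^esub> b i) = \<zero>\<^bsub>A\<^esub> \<longrightarrow> (\<forall>i\<in>F. c i = \<zero>\<^bsub>A\<^esub>))"

text \<open>\<open>R + R x\<^sub>1 + \<cdots> + R x\<^sub>n\<close>\<close>

definition pbw_linear :: "('a, 'b) ring_scheme \<Rightarrow> 'a set \<Rightarrow> nat \<Rightarrow> (nat \<Rightarrow> 'a) \<Rightarrow> 'a set"
  where "pbw_linear A R n x =
    {r \<oplus>\<^bsub>A\<^esub> (\<Oplus>\<^bsub>A\<^esub>k\<in>{1..n}. s k \<otimes>\<^bsub>A\<^esub> x k) | r s. r \<in> R \<and> s \<in> {1..n} \<rightarrow> R}"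

locale skew_PBW_extension = ring A for A (structure) +
  fixes R :: "'a set" and n :: nat and x :: "nat \<Rightarrow> 'a"
  assumes subring: "subring R A"
    and vars_closed: "x \<in> {1..n} \<rightarrow> carrier A"
    and basis: "left_basis A R (exponents n) (\<lambda>\<alpha>. pbw_monom A x \<alpha> n)"
    and var_coeff: "\<lbrakk> i \<in> {1..n}; r \<in> R - {\<zero>} \<rbrakk> \<Longrightarrow>
          \<exists>c \<in> R - {\<zero>}. x i \<otimes> r \<ominus> c \<otimes> x i \<in> R"
    and var_var: "\<lbrakk> i \<in> {1..n}; j \<in> {1..n} \<rbrakk> \<Longrightarrow>
          \<exists>c \<in> R - {\<zero>}. x j \<otimes> x i \<ominus> c \<otimes> (x i \<otimes> x j) \<in> pbw_linear A R n x"

text \<open>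
  The data \<open>\<sigma>\<^sub>i\<close>, \<open>\<delta>\<^sub>i\<close> (on \<open>R\<close>) and \<open>c\<^sub>i\<^sub>,\<^sub>j\<close> (for \<open>i < j\<close>) attached to a skew PBW extension. Freeness
  determines them uniquely; see \<open>sigma_eqI\<close>, \<open>var_commute\<close> and \<open>coeff_unique\<close> below.
\<close>

definition pbw_sigma :: "('a, 'b) ring_scheme \<Rightarrow> 'a set \<Rightarrow> (nat \<Rightarrow> 'a) \<Rightarrow> nat \<Rightarrow> 'a \<Rightarrow> 'a"
  where "pbw_sigma A R x i r = (THE s. s \<in> R \<and> x i \<otimes>\<^bsub>A\<^esub> r \<ominus>\<^bsub>A\<^esub> s \<otimes>\<^bsub>A\<^esub> x i \<in> R)"

definition pbw_delta :: "('a, 'b) ring_scheme \<Rightarrow> 'a set \<Rightarrow> (nat \<Rightarrow> 'a) \<Rightarrow> nat \<Rightarrow> 'a \<Rightarrow> 'a"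
  where "pbw_delta A R x i r = x i \<otimes>\<^bsub>A\<^esub> r \<ominus>\<^bsub>A\<^esub> pbw_sigma A R x i r \<otimes>\<^bsub>A\<^esub> x i"

definition pbw_coeff ::
    "('a, 'b) ring_scheme \<Rightarrow> 'a set \<Rightarrow> nat \<Rightarrow> (nat \<Rightarrow> 'a) \<Rightarrow> nat \<Rightarrow> nat \<Rightarrow> 'a"
  where "pbw_coeff A R n x i j =
    (THE c. c \<in> R \<and> x j \<otimes>\<^bsub>A\<^esub> x i \<ominus>\<^bsub>A\<^esub> c \<otimes>\<^bsub>A\<^esub> (x i \<otimes>\<^bsub>A\<^esub> x j) \<in> pbw_linear A R n x)"

definition pbw_Sigma :: "('a, 'b) ring_scheme \<Rightarrow> 'a set \<Rightarrow> nat \<Rightarrow> (nat \<Rightarrow> 'a) \<Rightarrow> ('a \<Rightarrow> 'a) set"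
  where "pbw_Sigma A R n x = pbw_sigma A R x ` {1..n}"

definition pbw_bijective :: "('a, 'b) ring_scheme \<Rightarrow> 'a set \<Rightarrow> nat \<Rightarrow> (nat \<Rightarrow> 'a) \<Rightarrow> bool"
  where "pbw_bijective A R n x \<longleftrightarrow>
    (\<forall>i\<in>{1..n}. bij_betw (pbw_sigma A R x i) R R) \<and>
    (\<forall>i\<in>{1..n}. \<forall>j\<in>{1..n}. i < j \<longrightarrow> pbw_coeff A R n x i j \<in> Units (A\<lparr>carrier := R\<rparr>))"

definition pbw_automorphism_type :: "('a, 'b) ring_scheme \<Rightarrow> 'a set \<Rightarrow> nat \<Rightarrow> (nat \<Rightarrow> 'a) \<Rightarrow> bool"
  where "pbw_automorphism_type A R n x \<longleftrightarrow>
    (\<forall>i\<in>{1..n}. (\<forall>r\<in>R. pbw_delta A R x i r = \<zero>\<^bsub>A\<^esub>) \<and> bij_betw (pbw_sigma A R x i) R R)"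


section \<open>Invariant ideals and prime ideals\<close>

definition invariant_ideal :: "('a, 'b) ring_scheme \<Rightarrow> ('a \<Rightarrow> 'a) set \<Rightarrow> 'a set \<Rightarrow> bool"
  where "invariant_ideal S \<Sigma> I \<longleftrightarrow> ideal I S \<and> (\<forall>\<sigma>\<in>\<Sigma>. \<sigma> ` I \<subseteq> I)"

definition sigma_prime_ideal :: "('a, 'b) ring_scheme \<Rightarrow> ('a \<Rightarrow> 'a) set \<Rightarrow> 'a set \<Rightarrow> bool"
  where "sigma_prime_ideal S \<Sigma> I \<longleftrightarrow>
    invariant_ideal S \<Sigma> I \<and> I \<noteq> carrier S \<and>
    (\<forall>J K. invariant_ideal S \<Sigma> J \<and> invariant_ideal S \<Sigma> K \<and> ideal_prod S J K \<subseteq> I \<longrightarrow>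
        J \<subseteq> I \<or> K \<subseteq> I)"

text \<open>
  Prime ideals of a not necessarily commutative ring; the library's \<open>primeideal\<close> requires a
  commutative ring and is elementwise.
\<close>

definition nc_prime_ideal :: "('a, 'b) ring_scheme \<Rightarrow> 'a set \<Rightarrow> bool"
  where "nc_prime_ideal S P \<longleftrightarrow>
    ideal P S \<and> P \<noteq> carrier S \<and>
    (\<forall>J K. ideal J S \<and> ideal K S \<and> ideal_prod S J K \<subseteq> P \<longrightarrow> J \<subseteq> P \<or> K \<subseteq> P)"

text \<open>
  \<open>IA\<close> and \<open>AI\<close> for a subset \<open>I\<close> of \<open>A\<close>: \<open>ideal_prod\<close> yields the finite sums of products and
  makes sense for arbitrary subsets, although \<open>I\<close> need not be an ideal of \<open>A\<close>.
\<close>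

definition right_extension :: "('a, 'b) ring_scheme \<Rightarrow> 'a set \<Rightarrow> 'a set"
  where "right_extension A I = ideal_prod A I (carrier A)"

definition left_extension :: "('a, 'b) ring_scheme \<Rightarrow> 'a set \<Rightarrow> 'a set"
  where "left_extension A I = ideal_prod A (carrier A) I"


section \<open>The data of a skew PBW extension are well defined\<close>

context skew_PBW_extension
begin

lemma R_closed [simp]: "r \<in> R \<Longrightarrow> r \<in> carrier A"
  using subringE(1)[OF subring] by blast

lemma R_ops [simp]:
  "\<zero> \<in> R" "\<one> \<in> R" "r \<in> R \<Longrightarrow> \<ominus> r \<in> R"
  "\<lbrakk> r \<in> R; s \<in> R \<rbrakk> \<Longrightarrow> r \<oplus> s \<in> R" "\<lbrakk> r \<in> R; s \<in> R \<rbrakk> \<Longrightarrow> r \<otimes> s \<in> R"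
  "\<lbrakk> r \<in> R; s \<in> R \<rbrakk> \<Longrightarrow> r \<ominus> s \<in> R"
  unfolding a_minus_def by (auto intro!: subringE(2,3,5-7)[OF subring])

lemma var_closed [simp]: "\<lbrakk> Suc 0 \<le> i; i \<le> n \<rbrakk> \<Longrightarrow> x i \<in> carrier A"
  using funcset_mem[OF vars_closed, of i] by simp

lemma independent:
  assumes "finite F" "F \<subseteq> exponents n" "c \<in> F \<rightarrow> R"
    and "(\<Oplus>\<alpha>\<in>F. c \<alpha> \<otimes> pbw_monom A x \<alpha> n) = \<zero>" and "\<alpha> \<in> F"
  shows "c \<alpha> = \<zero>"
proof -
  have "\<forall>F c. finite F \<and> F \<subseteq> exponents n \<and> c \<in> F \<rightarrow> R \<and>
      (\<Oplus>\<alpha>\<in>F. c \<alpha> \<otimes> pbw_monom A x \<alpha> n) = \<zero> \<longrightarrow> (\<forall>\<alpha>\<in>F. c \<alpha> = \<zero>)"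
    using basis unfolding left_basis_def by (elim conjE)
  from this[rule_format, of F c \<alpha>] show ?thesis using assms by simp
qed

abbreviation unit_exp :: "nat \<Rightarrow> nat \<Rightarrow> nat"
  where "unit_exp i \<equiv> (\<lambda>k. if k = i then 1 else 0)"

lemma monom_zero: "pbw_monom A x (\<lambda>k. 0) m = \<one>"
  by (induction m) auto

lemma monom_unit:
  assumes "m \<le> n" "i \<ge> 1"
  shows "pbw_monom A x (unit_exp i) m = (if i \<le> m then x i else \<one>)"
  using assms
proof (induction m)
  case (Suc m)
  then have "x (Suc m) \<in> carrier A" by simp
  moreover have "x i \<in> carrier A" if "i \<le> m" using that Suc by simp
  ultimately show ?case using Suc by (auto simp: le_Suc_eq)
qed auto

lemma monom_pair:
  assumes "m \<le> n" "1 \<le> i" "i < j"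
  shows "pbw_monom A x (\<lambda>k. unit_exp i k + unit_exp j k) m =
    (if j \<le> m then x i \<otimes> x j else if i \<le> m then x i else \<one>)"
  using assms
proof (induction m)
  case (Suc m)
  then have "x (Suc m) \<in> carrier A" by simp
  moreover have "x i \<in> carrier A" if "i \<le> m" using that Suc by simp
  ultimately show ?case using Suc by (auto simp: le_Suc_eq)
qed auto

lemma var_independent:
  assumes i: "i \<in> {1..n}" and R: "s \<in> R" "d \<in> R" and eq: "s \<otimes> x i \<oplus> d = \<zero>"
  shows "s = \<zero>" and "d = \<zero>"
proof -
  define z :: "nat \<Rightarrow> nat" where "z = (\<lambda>k. 0)"
  define c where "c = (\<lambda>\<alpha>::nat \<Rightarrow> nat. if \<alpha> = z then d else s)"
  have ne: "unit_exp i \<noteq> z" by (auto simp: z_def fun_eq_iff)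
  have cv: "c (unit_exp i) = s" "c z = d" using ne by (auto simp: c_def)
  have mon: "pbw_monom A x z n = \<one>" "pbw_monom A x (unit_exp i) n = x i"
    using monom_zero monom_unit[of n i] i by (simp_all add: z_def)
  have "(\<Oplus>\<alpha>\<in>insert (unit_exp i) {z}. c \<alpha> \<otimes> pbw_monom A x \<alpha> n) =
      c (unit_exp i) \<otimes> pbw_monom A x (unit_exp i) n \<oplus>
      (\<Oplus>\<alpha>\<in>{z}. c \<alpha> \<otimes> pbw_monom A x \<alpha> n)"
    by (rule finsum_insert) (use i R ne in \<open>auto simp: cv mon\<close>)
  also have "\<dots> = s \<otimes> x i \<oplus> d"
    using i R by (simp add: cv mon)
  finally have "(\<Oplus>\<alpha>\<in>{unit_exp i, z}. c \<alpha> \<otimes> pbw_monom A x \<alpha> n) = s \<otimes> x i \<oplus> d" .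
  then have sum: "(\<Oplus>\<alpha>\<in>{unit_exp i, z}. c \<alpha> \<otimes> pbw_monom A x \<alpha> n) = \<zero>" using eq by simp
  have sub: "{unit_exp i, z} \<subseteq> exponents n" using i by (auto simp: exponents_def z_def)
  have cR: "c \<in> {unit_exp i, z} \<rightarrow> R" using R by (auto simp: c_def)
  have "c (unit_exp i) = \<zero>" "c z = \<zero>"
    by (rule independent[OF _ sub cR sum]; simp)+
  then show "s = \<zero>" "d = \<zero>" by (simp_all only: cv)
qed

lemma coeff_independent:
  assumes ij: "1 \<le> i" "i < j" "j \<le> n" and c: "c \<in> R"
    and lin: "c \<otimes> (x i \<otimes> x j) \<in> pbw_linear A R n x"
  shows "c = \<zero>"
proof -
  obtain r s where rs: "r \<in> R" "s \<in> {1..n} \<rightarrow> R"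
    and eq: "c \<otimes> (x i \<otimes> x j) = r \<oplus> (\<Oplus>k\<in>{1..n}. s k \<otimes> x k)"
    using lin unfolding pbw_linear_def by blast
  define z :: "nat \<Rightarrow> nat" where "z = (\<lambda>k. 0)"
  define p where "p = (\<lambda>k. unit_exp i k + unit_exp j k)"
  define U where "U = unit_exp ` {1..n}"
  define u where "u = (\<lambda>\<alpha>::nat \<Rightarrow> nat. if \<alpha> = p then \<ominus> c else if \<alpha> = z then r
      else s (THE k. \<alpha> = unit_exp k))"
  have unit_inj: "unit_exp k = unit_exp l \<longleftrightarrow> k = l" for k l
    by (metis zero_neq_one)
  have pz: "p \<noteq> z" using ij by (auto simp: p_def z_def fun_eq_iff)
  have zU: "unit_exp k \<noteq> z" for k by (auto simp: z_def fun_eq_iff)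
  have pU: "unit_exp k \<noteq> p" for k
  proof
    assume eq: "unit_exp k = p"
    have "p i = 1" "p j = 1" using ij by (simp_all add: p_def)
    then have "unit_exp k i = 1" "unit_exp k j = 1"
      using fun_cong[OF eq, of i] fun_cong[OF eq, of j] by metis+
    then have "i = k" "j = k" by (meson zero_neq_one)+
    then show False using ij by simp
  qed
  have u: "u p = \<ominus> c" "u z = r" "u (unit_exp k) = s k" for k
    using pz zU pU by (auto simp: u_def unit_inj)
  have mon: "pbw_monom A x z n = \<one>" "pbw_monom A x p n = x i \<otimes> x j"
    "k \<in> {1..n} \<Longrightarrow> pbw_monom A x (unit_exp k) n = x k" for k
    using monom_zero monom_unit[of n k] monom_pair[of n i j] ij by (simp_all add: z_def p_def)
  have xs: "x i \<in> carrier A" "x j \<in> carrier A" using ij by simp_all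
  have sk: "s k \<in> R" if "k \<in> {1..n}" for k using rs that by blast
  have sumU: "(\<Oplus>\<alpha>\<in>U. u \<alpha> \<otimes> pbw_monom A x \<alpha> n) = (\<Oplus>k\<in>{1..n}. s k \<otimes> x k)"
  proof -
    have "(\<Oplus>\<alpha>\<in>U. u \<alpha> \<otimes> pbw_monom A x \<alpha> n) =
        (\<Oplus>k\<in>{1..n}. u (unit_exp k) \<otimes> pbw_monom A x (unit_exp k) n)"
      unfolding U_def
      by (rule finsum_reindex) (auto simp: u mon sk inj_on_def unit_inj)
    also have "\<dots> = (\<Oplus>k\<in>{1..n}. s k \<otimes> x k)"
      by (rule finsum_cong') (auto simp: u mon sk)
    finally show ?thesis .
  qed
  have "v \<notin> U" if "\<And>k. unit_exp k \<noteq> v" for v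
  proof
    assume "v \<in> U"
    then obtain k where "v = unit_exp k" unfolding U_def by (rule imageE)
    then show False using that[of k] by (rule notE[OF _ sym, rotated])
  qed
  then have "z \<notin> U" "p \<notin> U" using zU pU by blast+
  then have fU: "finite U" "z \<notin> U" "p \<notin> insert z U"
    using pz by (simp_all add: U_def)
  have carU: "(\<lambda>\<alpha>. u \<alpha> \<otimes> pbw_monom A x \<alpha> n) \<in> U \<rightarrow> carrier A"
    by (auto simp: U_def u mon sk)
  have "(\<Oplus>\<alpha>\<in>insert p (insert z U). u \<alpha> \<otimes> pbw_monom A x \<alpha> n) =
      u p \<otimes> pbw_monom A x p n \<oplus> (\<Oplus>\<alpha>\<in>insert z U. u \<alpha> \<otimes> pbw_monom A x \<alpha> n)"
    by (rule finsum_insert) (use fU carU c rs xs in \<open>auto simp: u mon\<close>)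
  also have "(\<Oplus>\<alpha>\<in>insert z U. u \<alpha> \<otimes> pbw_monom A x \<alpha> n) =
      u z \<otimes> pbw_monom A x z n \<oplus> (\<Oplus>\<alpha>\<in>U. u \<alpha> \<otimes> pbw_monom A x \<alpha> n)"
    by (rule finsum_insert) (use fU carU rs in \<open>auto simp: u mon\<close>)
  also have "u p \<otimes> pbw_monom A x p n \<oplus> \<dots> =
      \<ominus> c \<otimes> (x i \<otimes> x j) \<oplus> (r \<oplus> (\<Oplus>k\<in>{1..n}. s k \<otimes> x k))"
    using rs by (simp add: u mon sumU)
  also have "\<dots> = \<zero>"
    using c xs eq[symmetric] by (simp add: l_minus l_neg)
  finally have sum: "(\<Oplus>\<alpha>\<in>insert p (insert z U). u \<alpha> \<otimes> pbw_monom A x \<alpha> n) = \<zero>" .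
  have sub: "insert p (insert z U) \<subseteq> exponents n"
    using ij by (auto simp: exponents_def p_def z_def U_def)
  have uR: "u \<in> insert p (insert z U) \<rightarrow> R"
    using c rs sk by (auto simp: u U_def)
  have "u p = \<zero>" by (rule independent[OF _ sub uR sum]) (simp_all add: fU)
  then have "\<ominus> c = \<zero>" by (simp add: u)
  then show ?thesis using c by (metis R_closed minus_minus minus_zero)
qed

lemma linear_diff:
  assumes "a \<in> pbw_linear A R n x" "b \<in> pbw_linear A R n x"
  shows "a \<ominus> b \<in> pbw_linear A R n x"
proof -
  obtain r s where a: "r \<in> R" "s \<in> {1..n} \<rightarrow> R" "a = r \<oplus> (\<Oplus>k\<in>{1..n}. s k \<otimes> x k)"
    using assms(1) unfolding pbw_linear_def by blast
  obtain r' s' where b: "r' \<in> R" "s' \<in> {1..n} \<rightarrow> R" "b = r' \<oplus> (\<Oplus>k\<in>{1..n}. s' k \<otimes> x k)"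
    using assms(2) unfolding pbw_linear_def by blast
  have s: "s k \<in> R" "s' k \<in> R" if "k \<in> {1..n}" for k using a b that by blast+
  have c1: "(\<lambda>k. s k \<otimes> x k) \<in> {1..n} \<rightarrow> carrier A"
    and c2: "(\<lambda>k. s' k \<otimes> x k) \<in> {1..n} \<rightarrow> carrier A"
    and c3: "(\<lambda>k. (s k \<ominus> s' k) \<otimes> x k) \<in> {1..n} \<rightarrow> carrier A" using s by auto
  have "(\<Oplus>k\<in>{1..n}. s k \<otimes> x k) =
      (\<Oplus>k\<in>{1..n}. (s k \<ominus> s' k) \<otimes> x k \<oplus> s' k \<otimes> x k)"
  proof (rule finsum_cong')
    fix k assume k: "k \<in> {1..n}"
    then have "s k \<in> carrier A" "s' k \<in> carrier A" "x k \<in> carrier A" using s by auto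
    then show "s k \<otimes> x k = (s k \<ominus> s' k) \<otimes> x k \<oplus> s' k \<otimes> x k" by algebra
  qed (use c1 c2 c3 in auto)
  also have "\<dots> = (\<Oplus>k\<in>{1..n}. (s k \<ominus> s' k) \<otimes> x k) \<oplus> (\<Oplus>k\<in>{1..n}. s' k \<otimes> x k)"
    by (rule finsum_addf[OF c3 c2])
  finally have S: "(\<Oplus>k\<in>{1..n}. s k \<otimes> x k) =
      (\<Oplus>k\<in>{1..n}. (s k \<ominus> s' k) \<otimes> x k) \<oplus> (\<Oplus>k\<in>{1..n}. s' k \<otimes> x k)" .
  define P where "P = (\<Oplus>k\<in>{1..n}. (s k \<ominus> s' k) \<otimes> x k)"
  define Q where "Q = (\<Oplus>k\<in>{1..n}. s' k \<otimes> x k)"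
  have PQ: "P \<in> carrier A" "Q \<in> carrier A" "r \<in> carrier A" "r' \<in> carrier A"
    using a b finsum_closed[OF c3] finsum_closed[OF c2] by (auto simp: P_def Q_def)
  have "a \<ominus> b = (r \<oplus> (P \<oplus> Q)) \<ominus> (r' \<oplus> Q)"
    unfolding a(3) b(3) S P_def Q_def ..
  also have "\<dots> = (r \<ominus> r') \<oplus> P" using PQ by algebra
  finally show ?thesis
    unfolding pbw_linear_def P_def using a(1) b(1) s
    by (auto intro!: exI[of _ "r \<ominus> r'"] exI[of _ "\<lambda>k. s k \<ominus> s' k"])
qed

theorem coeff_unique:
  assumes ij: "1 \<le> i" "i < j" "j \<le> n"
    and c: "c \<in> R" "x j \<otimes> x i \<ominus> c \<otimes> (x i \<otimes> x j) \<in> pbw_linear A R n x"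
  shows "pbw_coeff A R n x i j = c"
  unfolding pbw_coeff_def
proof (rule the_equality)
  fix d assume d: "d \<in> R \<and> x j \<otimes> x i \<ominus> d \<otimes> (x i \<otimes> x j) \<in> pbw_linear A R n x"
  have car: "x i \<in> carrier A" "x j \<in> carrier A" "c \<in> carrier A" "d \<in> carrier A"
    using ij c d by simp_all
  then have "(d \<ominus> c) \<otimes> (x i \<otimes> x j) =
      (x j \<otimes> x i \<ominus> c \<otimes> (x i \<otimes> x j)) \<ominus> (x j \<otimes> x i \<ominus> d \<otimes> (x i \<otimes> x j))"
  proof -
    have "(d \<ominus> c) \<otimes> p = (q \<ominus> c \<otimes> p) \<ominus> (q \<ominus> d \<otimes> p)"
      if "p \<in> carrier A" "q \<in> carrier A" for p q
      using that car by algebra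
    from this[of "x i \<otimes> x j" "x j \<otimes> x i"] show ?thesis using car by blast
  qed
  then have "(d \<ominus> c) \<otimes> (x i \<otimes> x j) \<in> pbw_linear A R n x"
    using linear_diff c d by simp
  then have "d \<ominus> c = \<zero>" using coeff_independent[OF ij] c d by simp
  then show "d = c" using car by simp
qed (use c in simp)

lemma sigma_eqI:
  assumes i: "i \<in> {1..n}" and r: "r \<in> R" and s: "s \<in> R" and d: "d \<in> R"
    and eq: "x i \<otimes> r = s \<otimes> x i \<oplus> d"
  shows "pbw_sigma A R x i r = s" and "pbw_delta A R x i r = d"
proof -
  have car: "x i \<in> carrier A" "r \<in> carrier A" "s \<in> carrier A" "d \<in> carrier A"
    using i r s d by simp_all
  have cancel: "(p \<oplus> q) \<ominus> p = q" if "p \<in> carrier A" "q \<in> carrier A" for p q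
    using that by algebra
  have diff: "x i \<otimes> r \<ominus> s \<otimes> x i = d" using cancel car by (simp add: eq)
  show sig: "pbw_sigma A R x i r = s"
    unfolding pbw_sigma_def
  proof (rule the_equality)
    show "s \<in> R \<and> x i \<otimes> r \<ominus> s \<otimes> x i \<in> R" using diff s d by simp
    fix t assume t: "t \<in> R \<and> x i \<otimes> r \<ominus> t \<otimes> x i \<in> R"
    have car': "t \<in> carrier A" using t by simp
    have "(s \<ominus> t) \<otimes> x i \<oplus> (d \<ominus> (x i \<otimes> r \<ominus> t \<otimes> x i)) = \<zero>"
      unfolding eq using car car' by algebra
    moreover have "s \<ominus> t \<in> R" "d \<ominus> (x i \<otimes> r \<ominus> t \<otimes> x i) \<in> R" using t s d by simp_all
    ultimately have "s \<ominus> t = \<zero>" using var_independent(1)[OF i] by blast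
    then show "t = s" using car car' by simp
  qed
  show "pbw_delta A R x i r = d" by (simp add: pbw_delta_def sig diff)
qed

lemma sigma_delta_exist:
  assumes i: "i \<in> {1..n}" and r: "r \<in> R"
  obtains s d where "s \<in> R" "d \<in> R" "x i \<otimes> r = s \<otimes> x i \<oplus> d" "r \<noteq> \<zero> \<Longrightarrow> s \<noteq> \<zero>"
proof (cases "r = \<zero>")
  case True
  then show ?thesis using that[of \<zero> \<zero>] i by simp
next
  case False
  then obtain c where c: "c \<in> R - {\<zero>}" "x i \<otimes> r \<ominus> c \<otimes> x i \<in> R" using var_coeff i r by blast
  have "p = q \<oplus> (p \<ominus> q)" if "p \<in> carrier A" "q \<in> carrier A" for p q using that by algebra
  from this[of "x i \<otimes> r" "c \<otimes> x i"] c i r that[of c "x i \<otimes> r \<ominus> c \<otimes> x i"]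
  show ?thesis by auto
qed

theorem var_commute:
  assumes "i \<in> {1..n}" "r \<in> R"
  shows "x i \<otimes> r = pbw_sigma A R x i r \<otimes> x i \<oplus> pbw_delta A R x i r"
    and "pbw_sigma A R x i r \<in> R" and "pbw_delta A R x i r \<in> R"
    and "r \<noteq> \<zero> \<Longrightarrow> pbw_sigma A R x i r \<noteq> \<zero>"
  using assms by (metis sigma_delta_exist sigma_eqI)+

theorem sigma_delta_add:
  assumes i: "i \<in> {1..n}" and r: "r \<in> R" "s \<in> R"
  shows "pbw_sigma A R x i (r \<oplus> s) = pbw_sigma A R x i r \<oplus> pbw_sigma A R x i s"
    and "pbw_delta A R x i (r \<oplus> s) = pbw_delta A R x i r \<oplus> pbw_delta A R x i s"
proof -
  note vc = var_commute[OF i]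
  have car: "x i \<in> carrier A" "r \<in> carrier A" "s \<in> carrier A"
    "pbw_sigma A R x i r \<in> carrier A" "pbw_delta A R x i r \<in> carrier A"
    "pbw_sigma A R x i s \<in> carrier A" "pbw_delta A R x i s \<in> carrier A" using i r vc by simp_all
  have "x i \<otimes> (r \<oplus> s) = x i \<otimes> r \<oplus> x i \<otimes> s" using car by algebra
  also have "\<dots> = (pbw_sigma A R x i r \<oplus> pbw_sigma A R x i s) \<otimes> x i \<oplus>
      (pbw_delta A R x i r \<oplus> pbw_delta A R x i s)"
    unfolding vc(1)[OF r(1)] vc(1)[OF r(2)] using car by algebra
  finally have eq: "x i \<otimes> (r \<oplus> s) = \<dots>" .
  show "pbw_sigma A R x i (r \<oplus> s) = pbw_sigma A R x i r \<oplus> pbw_sigma A R x i s"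
    and "pbw_delta A R x i (r \<oplus> s) = pbw_delta A R x i r \<oplus> pbw_delta A R x i s"
    using sigma_eqI[OF i _ _ _ eq] r vc by simp_all
qed

theorem sigma_delta_mult:
  assumes i: "i \<in> {1..n}" and r: "r \<in> R" "s \<in> R"
  shows "pbw_sigma A R x i (r \<otimes> s) = pbw_sigma A R x i r \<otimes> pbw_sigma A R x i s"
    and "pbw_delta A R x i (r \<otimes> s) =
      pbw_sigma A R x i r \<otimes> pbw_delta A R x i s \<oplus> pbw_delta A R x i r \<otimes> s"
proof -
  note vc = var_commute[OF i]
  have car: "x i \<in> carrier A" "r \<in> carrier A" "s \<in> carrier A"
    "pbw_sigma A R x i r \<in> carrier A" "pbw_delta A R x i r \<in> carrier A"
    "pbw_sigma A R x i s \<in> carrier A" "pbw_delta A R x i s \<in> carrier A" using i r vc by simp_all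
  have "x i \<otimes> (r \<otimes> s) = (pbw_sigma A R x i r \<otimes> x i \<oplus> pbw_delta A R x i r) \<otimes> s"
    using car vc(1)[OF r(1)] by (simp add: m_assoc[symmetric])
  also have "\<dots> = pbw_sigma A R x i r \<otimes> (x i \<otimes> s) \<oplus> pbw_delta A R x i r \<otimes> s"
    using car by (simp add: l_distr m_assoc)
  also have "\<dots> = (pbw_sigma A R x i r \<otimes> pbw_sigma A R x i s) \<otimes> x i \<oplus>
      (pbw_sigma A R x i r \<otimes> pbw_delta A R x i s \<oplus> pbw_delta A R x i r \<otimes> s)"
    unfolding vc(1)[OF r(2)] using car by (simp add: r_distr m_assoc a_assoc)
  finally have eq: "x i \<otimes> (r \<otimes> s) = \<dots>" .
  show "pbw_sigma A R x i (r \<otimes> s) = pbw_sigma A R x i r \<otimes> pbw_sigma A R x i s"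
    and "pbw_delta A R x i (r \<otimes> s) =
      pbw_sigma A R x i r \<otimes> pbw_delta A R x i s \<oplus> pbw_delta A R x i r \<otimes> s"
    using sigma_eqI[OF i _ _ _ eq] r vc by simp_all
qed

theorem sigma_inj:
  assumes i: "i \<in> {1..n}"
  shows "inj_on (pbw_sigma A R x i) R"
proof (rule inj_onI)
  fix r s assume rs: "r \<in> R" "s \<in> R" and eq: "pbw_sigma A R x i r = pbw_sigma A R x i s"
  have "r = (r \<ominus> s) \<oplus> s" using R_closed[OF rs(1)] R_closed[OF rs(2)] by algebra
  then have "pbw_sigma A R x i r = pbw_sigma A R x i (r \<ominus> s) \<oplus> pbw_sigma A R x i s"
    using sigma_delta_add(1)[OF i, of "r \<ominus> s" s] rs by simp
  then have "pbw_sigma A R x i (r \<ominus> s) = \<zero>"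
    using eq var_commute(2)[OF i] rs by (simp add: add.r_cancel_one')
  then have "r \<ominus> s = \<zero>" using var_commute(4)[OF i, of "r \<ominus> s"] rs by auto
  then show "r = s" using rs by simp
qed

theorem sigma_ring_hom:
  assumes i: "i \<in> {1..n}"
  shows "pbw_sigma A R x i \<in> ring_hom (A\<lparr>carrier := R\<rparr>) (A\<lparr>carrier := R\<rparr>)"
proof (rule ring_hom_memI)
  have "pbw_sigma A R x i \<one> = \<one>" by (rule sigma_eqI(1)[OF i, of _ _ \<zero>]) (use i in simp_all)
  then show "pbw_sigma A R x i \<one>\<^bsub>A\<lparr>carrier := R\<rparr>\<^esub> = \<one>\<^bsub>A\<lparr>carrier := R\<rparr>\<^esub>" by simp
qed (simp_all add: var_commute(2)[OF i] sigma_delta_add(1)[OF i] sigma_delta_mult(1)[OF i])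

end

end

theory Submission
  imports Defs "HOL-Library.Fun_Lexorder" "HOL-Library.Function_Algebras"
begin

text \<open>
  The set \<open>IA\<close> consists of the elements of \<open>A\<close> all of whose coefficients lie in \<open>I\<close>, whence
  \<open>IA \<inter> R = I\<close>, and \<open>(JA)(KA) \<subseteq> IA\<close> if \<open>J\<close> and \<open>K\<close> are \<open>\<Sigma>\<close>-invariant with \<open>JK \<subseteq> I\<close>.
  Conversely, \<open>x\<^sup>\<mu> x\<^sup>\<nu>\<close> is a unit multiple of \<open>x\<^bsup>\<mu>+\<nu>\<^esup>\<close> up to terms of lower degree, so the
  leading coefficients (for the degree-lexicographic order) of an ideal \<open>J\<close> of \<open>A\<close> form a
  \<open>\<Sigma>\<close>-invariant ideal \<open>L(J)\<close> of \<open>R\<close>. As \<open>R\<close> is Noetherian, each \<open>\<sigma>\<^sub>i\<close> maps \<open>L(K)\<close> onto itself;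
  this undoes the twist in the leading coefficient of a product, and \<open>JK \<subseteq> IA\<close> implies
  \<open>L(J) L(K) \<subseteq> I\<close>. If \<open>L(J) \<subseteq> I\<close> and \<open>IA \<subseteq> J\<close>, stripping leading terms gives \<open>J \<subseteq> IA\<close>.
\<close>

section \<open>Ideals under a surjective ring endomorphism\<close>

text \<open>The chain of the ideals \<open>{r. \<sigma>\<^sup>k r \<in> L}\<close> is increasing and hence stationary.\<close>

lemma (in noetherian_ring) ideal_subset_image:
  assumes hom: "h \<in> ring_hom R R" and surj: "h ` carrier R = carrier R"
    and L: "ideal L R" and inv: "h ` L \<subseteq> L"
  shows "L \<subseteq> h ` L"
proof
  interpret L: ideal L R by (rule L)
  interpret h: ring_hom_ring R R h
    using hom ring_axioms by (simp add: ring_hom_ring_def ring_hom_ring_axioms_def)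
  have pow_closed: "(h ^^ k) r \<in> carrier R" if "r \<in> carrier R" for k r
    using that by (induction k) auto
  have pow_surj: "\<exists>s\<in>carrier R. (h ^^ k) s = r" if "r \<in> carrier R" for k r
    using that
  proof (induction k arbitrary: r)
    case (Suc k)
    then obtain q where q: "q \<in> carrier R" "h q = r" using surj by (metis imageE)
    then obtain s where "s \<in> carrier R" "(h ^^ k) s = q" using Suc.IH by blast
    then show ?case using q by (auto intro!: bexI[of _ s])
  qed auto
  define C where "C = (\<lambda>k. {r \<in> carrier R. (h ^^ k) r \<in> L})"
  have pow_add: "(h ^^ k) (r \<oplus> s) = (h ^^ k) r \<oplus> (h ^^ k) s"
    and pow_mult: "(h ^^ k) (r \<otimes> s) = (h ^^ k) r \<otimes> (h ^^ k) s"
    if "r \<in> carrier R" "s \<in> carrier R" for k r s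
    using that by (induction k) (auto simp: pow_closed)
  have pow_minus: "(h ^^ k) (\<ominus> r) = \<ominus> (h ^^ k) r" if "r \<in> carrier R" for k r
    using that by (induction k) (auto simp: pow_closed)
  have pow_zero: "(h ^^ k) \<zero> = \<zero>" for k by (induction k) auto
  have ideal_C: "ideal (C k) R" for k
  proof (rule idealI[OF ring_axioms])
    show "subgroup (C k) (add_monoid R)"
    proof (rule add.subgroupI)
      have "\<zero> \<in> C k"
        using additive_subgroup.zero_closed[OF L.additive_subgroup_axioms] by (simp add: C_def pow_zero)
      then show "C k \<noteq> {}" by blast
    next
      fix a assume "a \<in> C k"
      then show "\<ominus> a \<in> C k"
        using additive_subgroup.a_inv_closed[OF L.additive_subgroup_axioms]
        by (simp add: C_def pow_minus)
    next
      fix a b assume "a \<in> C k" "b \<in> C k"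
      then show "a \<oplus> b \<in> C k"
        using additive_subgroup.a_closed[OF L.additive_subgroup_axioms]
        by (simp add: C_def pow_add)
    qed (simp add: C_def)
  next
    fix a b assume "a \<in> C k" "b \<in> carrier R"
    then show "b \<otimes> a \<in> C k" "a \<otimes> b \<in> C k"
      using L.I_l_closed L.I_r_closed by (simp_all add: C_def pow_mult pow_closed)
  qed
  have "C k \<subseteq> C (Suc k)" for k using inv by (auto simp: C_def)
  then have mono: "j \<le> k \<Longrightarrow> C j \<subseteq> C k" for j k by (rule lift_Suc_mono_le)
  have "C j \<subseteq> C k \<or> C k \<subseteq> C j" for j k using mono nat_le_linear[of j k] by blast
  then have "subset.chain {I. ideal I R} (range C)"
    unfolding subset_chain_def using ideal_C by blast
  then obtain m where m: "\<Union>(range C) = C m" using ideal_chain_is_trivial[of "range C"] by auto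
  \<comment> \<open>A preimage \<open>s\<close> of \<open>r\<close> under \<open>h ^^ Suc m\<close>
    lies in \<open>C (Suc m)\<close>, hence in \<open>C m\<close>; so \<open>r\<close> is the image
    under \<open>h\<close> of the element \<open>(h ^^ m) s\<close> of \<open>L\<close>.\<close>
  fix r assume r: "r \<in> L"
  then obtain s where s: "s \<in> carrier R" "(h ^^ Suc m) s = r" using pow_surj L.Icarr by blast
  then have "s \<in> C (Suc m)" using r by (simp add: C_def)
  then have "s \<in> C m" using m by blast
  then have "(h ^^ m) s \<in> L" by (simp add: C_def)
  then show "r \<in> h ` L" using s(2) by auto
qed

section \<open>Coefficients with respect to the monomial basis\<close>

context skew_PBW_extension
begin

abbreviation RR where "RR \<equiv> A\<lparr>carrier := R\<rparr>"

abbreviation mon :: "(nat \<Rightarrow> nat) \<Rightarrow> 'a"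
  where "mon \<alpha> \<equiv> pbw_monom A x \<alpha> n"

abbreviation \<sigma> :: "nat \<Rightarrow> 'a \<Rightarrow> 'a"
  where "\<sigma> \<equiv> pbw_sigma A R x"

lemma monom_closed: "m \<le> n \<Longrightarrow> pbw_monom A x \<alpha> m \<in> carrier A"
  by (induction m) auto

lemma mon_closed [simp]: "mon \<alpha> \<in> carrier A"
  by (rule monom_closed) simp

text \<open>The coefficients form a total function, zero outside a finite set of exponents. Sums
  then become pointwise, and uniqueness becomes an equality of functions, with no index sets to
  compare.\<close>

definition pbw_repr :: "'a \<Rightarrow> ((nat \<Rightarrow> nat) \<Rightarrow> 'a) \<Rightarrow> bool"
  where "pbw_repr a c \<longleftrightarrow> (\<forall>\<mu>. c \<mu> \<in> R) \<and> finite {\<mu>. c \<mu> \<noteq> \<zero>} \<and>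
    {\<mu>. c \<mu> \<noteq> \<zero>} \<subseteq> exponents n \<and> a = (\<Oplus>\<mu>\<in>{\<mu>. c \<mu> \<noteq> \<zero>}. c \<mu> \<otimes> mon \<mu>)"

lemma pbw_reprI:
  assumes "finite F" "F \<subseteq> exponents n" "\<And>\<mu>. c \<mu> \<in> R" "\<And>\<mu>. \<mu> \<notin> F \<Longrightarrow> c \<mu> = \<zero>"
    and "a = (\<Oplus>\<mu>\<in>F. c \<mu> \<otimes> mon \<mu>)"
  shows "pbw_repr a c"
proof -
  have sub: "{\<mu>. c \<mu> \<noteq> \<zero>} \<subseteq> F" using assms(4) by auto
  have "(\<Oplus>\<mu>\<in>{\<mu>. c \<mu> \<noteq> \<zero>}. c \<mu> \<otimes> mon \<mu>) = (\<Oplus>\<mu>\<in>F. c \<mu> \<otimes> mon \<mu>)"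
    by (rule add.finprod_mono_neutral_cong_left) (use assms sub in auto)
  then show ?thesis
    unfolding pbw_repr_def using assms sub finite_subset[OF sub] by auto
qed

lemma pbw_repr_expand:
  assumes "pbw_repr a c" "finite F" "{\<mu>. c \<mu> \<noteq> \<zero>} \<subseteq> F"
  shows "a = (\<Oplus>\<mu>\<in>F. c \<mu> \<otimes> mon \<mu>)"
proof -
  have c: "c \<mu> \<in> carrier A" for \<mu> using assms(1) by (simp add: pbw_repr_def)
  have "(\<Oplus>\<mu>\<in>{\<mu>. c \<mu> \<noteq> \<zero>}. c \<mu> \<otimes> mon \<mu>) = (\<Oplus>\<mu>\<in>F. c \<mu> \<otimes> mon \<mu>)"
    by (rule add.finprod_mono_neutral_cong_left) (use assms c in auto)
  then show ?thesis using assms(1) by (simp add: pbw_repr_def)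
qed

lemma pbw_repr_closed:
  assumes "pbw_repr a c"
  shows "a \<in> carrier A" "c \<mu> \<in> R" "c \<mu> \<in> carrier A"
proof -
  show "c \<mu> \<in> R" "c \<mu> \<in> carrier A" using assms by (simp_all add: pbw_repr_def)
  have "(\<Oplus>\<mu>\<in>{\<mu>. c \<mu> \<noteq> \<zero>}. c \<mu> \<otimes> mon \<mu>) \<in> carrier A"
    by (rule finsum_closed) (use assms in \<open>auto simp: pbw_repr_def\<close>)
  then show "a \<in> carrier A" using assms by (simp add: pbw_repr_def)
qed

lemma pbw_repr_support:
  assumes "pbw_repr a c"
  shows "finite {\<mu>. c \<mu> \<noteq> \<zero>}" "c \<mu> \<noteq> \<zero> \<Longrightarrow> \<mu> \<in> exponents n"
  using assms by (auto simp: pbw_repr_def)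

lemma pbw_repr_zero: "pbw_repr \<zero> (\<lambda>\<mu>. \<zero>)"
  by (rule pbw_reprI[of "{}"]) auto

lemma pbw_repr_monom:
  assumes "r \<in> R" "\<mu> \<in> exponents n"
  shows "pbw_repr (r \<otimes> mon \<mu>) (\<lambda>\<nu>. if \<nu> = \<mu> then r else \<zero>)"
  by (rule pbw_reprI[of "{\<mu>}"]) (use assms in auto)

lemma pbw_repr_add:
  assumes a: "pbw_repr a c" and b: "pbw_repr b d"
  shows "pbw_repr (a \<oplus> b) (\<lambda>\<mu>. c \<mu> \<oplus> d \<mu>)"
proof (rule pbw_reprI)
  let ?F = "{\<mu>. c \<mu> \<noteq> \<zero>} \<union> {\<mu>. d \<mu> \<noteq> \<zero>}"
  note cl = pbw_repr_closed[OF a] pbw_repr_closed[OF b]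
  show fin: "finite ?F" using pbw_repr_support(1) a b by simp
  show "?F \<subseteq> exponents n" using pbw_repr_support(2) a b by blast
  have "a \<oplus> b = (\<Oplus>\<mu>\<in>?F. c \<mu> \<otimes> mon \<mu>) \<oplus> (\<Oplus>\<mu>\<in>?F. d \<mu> \<otimes> mon \<mu>)"
    using pbw_repr_expand[OF a fin] pbw_repr_expand[OF b fin] by simp
  also have "\<dots> = (\<Oplus>\<mu>\<in>?F. c \<mu> \<otimes> mon \<mu> \<oplus> d \<mu> \<otimes> mon \<mu>)"
    by (rule finsum_addf[symmetric]) (use cl in auto)
  also have "\<dots> = (\<Oplus>\<mu>\<in>?F. (c \<mu> \<oplus> d \<mu>) \<otimes> mon \<mu>)"
    by (rule finsum_cong') (use cl in \<open>auto simp: l_distr\<close>)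
  finally show "a \<oplus> b = (\<Oplus>\<mu>\<in>?F. (c \<mu> \<oplus> d \<mu>) \<otimes> mon \<mu>)" .
qed (use pbw_repr_closed[OF a] pbw_repr_closed[OF b] in auto)

lemma pbw_repr_smult:
  assumes r: "r \<in> R" and a: "pbw_repr a c"
  shows "pbw_repr (r \<otimes> a) (\<lambda>\<mu>. r \<otimes> c \<mu>)"
proof (rule pbw_reprI)
  let ?F = "{\<mu>. c \<mu> \<noteq> \<zero>}"
  note cl = pbw_repr_closed[OF a]
  show fin: "finite ?F" using pbw_repr_support(1) a by simp
  show "?F \<subseteq> exponents n" using pbw_repr_support(2) a by blast
  have "r \<otimes> a = r \<otimes> (\<Oplus>\<mu>\<in>?F. c \<mu> \<otimes> mon \<mu>)"
    using pbw_repr_expand[OF a fin] by simp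
  also have "\<dots> = (\<Oplus>\<mu>\<in>?F. r \<otimes> (c \<mu> \<otimes> mon \<mu>))"
    by (rule finsum_rdistr) (use cl r fin in auto)
  also have "\<dots> = (\<Oplus>\<mu>\<in>?F. (r \<otimes> c \<mu>) \<otimes> mon \<mu>)"
    by (rule finsum_cong') (use cl r in \<open>auto simp: m_assoc\<close>)
  finally show "r \<otimes> a = (\<Oplus>\<mu>\<in>?F. (r \<otimes> c \<mu>) \<otimes> mon \<mu>)" .
qed (use pbw_repr_closed[OF a] r in auto)

lemma pbw_repr_exists:
  assumes "a \<in> carrier A"
  obtains c where "pbw_repr a c"
proof -
  obtain F c where F: "finite F" "F \<subseteq> exponents n" "c \<in> F \<rightarrow> R"
    and a: "a = (\<Oplus>\<mu>\<in>F. c \<mu> \<otimes> mon \<mu>)"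
    using basis assms unfolding left_basis_def by metis
  \<comment> \<open>The basis property says nothing about \<open>c\<close> outside \<open>F\<close>,
    where a representation has to be zero.\<close>
  define d where "d = (\<lambda>\<mu>. if \<mu> \<in> F then c \<mu> else \<zero>)"
  have "pbw_repr a d"
  proof (rule pbw_reprI[OF F(1,2)])
    show "a = (\<Oplus>\<mu>\<in>F. d \<mu> \<otimes> mon \<mu>)"
      unfolding a by (rule finsum_cong') (use F in \<open>auto simp: d_def Pi_iff\<close>)
  qed (use F in \<open>auto simp: d_def\<close>)
  then show thesis by (rule that)
qed

lemma pbw_repr_unique:
  assumes a: "pbw_repr a c" and b: "pbw_repr a d"
  shows "c = d"
proof
  fix \<mu>
  \<comment> \<open>The difference is written as a sum with a multiple by
    \<open>\<ominus> \<one>\<close>, so that \<open>pbw_repr_add\<close> and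
    \<open>pbw_repr_smult\<close> represent \<open>\<zero>\<close> by \<open>?e\<close>.\<close>
  let ?e = "\<lambda>\<mu>. c \<mu> \<oplus> \<ominus> \<one> \<otimes> d \<mu>"
  note cl = pbw_repr_closed[OF a] pbw_repr_closed[OF b]
  have "a \<oplus> \<ominus> \<one> \<otimes> a = \<zero>" using cl by (simp add: l_minus r_neg)
  then have e: "pbw_repr \<zero> ?e"
    using pbw_repr_add[OF a pbw_repr_smult[OF _ b, of "\<ominus> \<one>"]] by simp
  \<comment> \<open>Independence speaks only of indices in the chosen finite set. That set is the
    support of \<open>?e\<close>, and \<open>\<mu>\<close> belongs to it only under the assumption
    to be refuted.\<close>
  have "?e \<mu> = \<zero>"
  proof (rule ccontr)
    assume ne: "?e \<mu> \<noteq> \<zero>"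
    have "?e \<mu> = \<zero>"
    proof (rule independent[where F = "{\<mu>. ?e \<mu> \<noteq> \<zero>}" and c = ?e])
      show "\<mu> \<in> {\<mu>. ?e \<mu> \<noteq> \<zero>}" using ne by simp
    qed (use e in \<open>auto simp: pbw_repr_def\<close>)
    then show False using ne by simp
  qed
  then have "c \<mu> \<ominus> d \<mu> = \<zero>" using cl by (simp add: l_minus a_minus_def)
  then show "c \<mu> = d \<mu>" using cl by simp
qed

section \<open>Spans of monomials with restricted coefficients and exponents\<close>

text \<open>One notion with several uses: with \<open>S = exponents n\<close> and an invariant ideal
  \<open>I\<close> it turns out to be \<open>IA\<close>, while \<open>I = R\<close> and a bound on
  the exponents in \<open>S\<close> give the sets of error terms. Supports lie in
  \<open>exponents n\<close> anyway, so \<open>S\<close> may contain other functions as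
  well.\<close>

definition pbw_span :: "'a set \<Rightarrow> (nat \<Rightarrow> nat) set \<Rightarrow> 'a set"
  where "pbw_span I S = {a. \<exists>c. pbw_repr a c \<and> (\<forall>\<mu>. c \<mu> \<in> I) \<and> (\<forall>\<mu>. c \<mu> \<noteq> \<zero> \<longrightarrow> \<mu> \<in> S)}"

lemma pbw_span_closed: "a \<in> pbw_span I S \<Longrightarrow> a \<in> carrier A"
  using pbw_repr_closed by (auto simp: pbw_span_def)

lemma pbw_span_mono: "\<lbrakk> I \<subseteq> I'; S \<subseteq> S' \<rbrakk> \<Longrightarrow> pbw_span I S \<subseteq> pbw_span I' S'"
  unfolding pbw_span_def by blast

lemma pbw_span_all: "pbw_span R (exponents n) = carrier A"
proof
  show "carrier A \<subseteq> pbw_span R (exponents n)"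
  proof
    fix a assume "a \<in> carrier A"
    then obtain c where "pbw_repr a c" by (rule pbw_repr_exists)
    then show "a \<in> pbw_span R (exponents n)"
      using pbw_repr_closed pbw_repr_support unfolding pbw_span_def by blast
  qed
qed (use pbw_span_closed in blast)

lemma RR_ring: "ring RR"
  using subring by (rule subring_is_ring)

lemma RR_ideal: "ideal R RR"
  using ring.oneideal[OF RR_ring] by simp

lemma RR_idealD:
  assumes "ideal I RR"
  shows "I \<subseteq> R" "\<zero> \<in> I" "\<lbrakk> r \<in> I; s \<in> I \<rbrakk> \<Longrightarrow> r \<oplus> s \<in> I"
    "\<lbrakk> r \<in> R; s \<in> I \<rbrakk> \<Longrightarrow> r \<otimes> s \<in> I" "\<lbrakk> r \<in> I; s \<in> R \<rbrakk> \<Longrightarrow> r \<otimes> s \<in> I"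
proof -
  interpret I: ideal I RR by fact
  show "I \<subseteq> R" using I.a_subset by simp
  show "\<zero> \<in> I" using additive_subgroup.zero_closed[OF ideal.axioms(1)[OF assms]] by simp
  show "\<lbrakk> r \<in> I; s \<in> I \<rbrakk> \<Longrightarrow> r \<oplus> s \<in> I" using additive_subgroup.a_closed[OF ideal.axioms(1)[OF assms], of r s] by simp
  show "\<lbrakk> r \<in> R; s \<in> I \<rbrakk> \<Longrightarrow> r \<otimes> s \<in> I" using I.I_l_closed[of s r] by simp
  show "\<lbrakk> r \<in> I; s \<in> R \<rbrakk> \<Longrightarrow> r \<otimes> s \<in> I" using I.I_r_closed[of r s] by simp
qed

lemma pbw_span_zero:
  assumes "ideal I RR"
  shows "\<zero> \<in> pbw_span I S"
  unfolding pbw_span_def using pbw_repr_zero RR_idealD(2)[OF assms] by auto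

lemma pbw_span_add:
  assumes I: "ideal I RR" and "a \<in> pbw_span I S" "b \<in> pbw_span I S"
  shows "a \<oplus> b \<in> pbw_span I S"
proof -
  obtain c d where c: "pbw_repr a c" "\<And>\<mu>. c \<mu> \<in> I" "\<And>\<mu>. c \<mu> \<noteq> \<zero> \<Longrightarrow> \<mu> \<in> S"
    and d: "pbw_repr b d" "\<And>\<mu>. d \<mu> \<in> I" "\<And>\<mu>. d \<mu> \<noteq> \<zero> \<Longrightarrow> \<mu> \<in> S"
    using assms unfolding pbw_span_def by auto
  have "\<mu> \<in> S" if "c \<mu> \<oplus> d \<mu> \<noteq> \<zero>" for \<mu>
    using that c(3)[of \<mu>] d(3)[of \<mu>] by (cases "c \<mu> = \<zero>"; cases "d \<mu> = \<zero>") auto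
  then show ?thesis
    unfolding pbw_span_def using pbw_repr_add[OF c(1) d(1)] RR_idealD(3)[OF I c(2) d(2)] by auto
qed

lemma pbw_span_smult:
  assumes I: "ideal I RR" and r: "r \<in> R" and "a \<in> pbw_span I S"
  shows "r \<otimes> a \<in> pbw_span I S"
proof -
  obtain c where c: "pbw_repr a c" "\<And>\<mu>. c \<mu> \<in> I" "\<And>\<mu>. c \<mu> \<noteq> \<zero> \<Longrightarrow> \<mu> \<in> S"
    using assms unfolding pbw_span_def by auto
  have "\<mu> \<in> S" if "r \<otimes> c \<mu> \<noteq> \<zero>" for \<mu>
    using that c(3)[of \<mu>] r by (cases "c \<mu> = \<zero>") auto
  then show ?thesis
    unfolding pbw_span_def using pbw_repr_smult[OF r c(1)] RR_idealD(4)[OF I r c(2)] by auto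
qed

lemma pbw_span_uminus:
  assumes I: "ideal I RR" and "a \<in> pbw_span I S"
  shows "\<ominus> a \<in> pbw_span I S"
  using pbw_span_smult[OF I _ assms(2), of "\<ominus> \<one>"] pbw_span_closed[OF assms(2)]
  by (simp add: l_minus)

lemma pbw_span_monom:
  assumes "ideal I RR" "r \<in> I" "\<mu> \<in> S" "\<mu> \<in> exponents n"
  shows "r \<otimes> mon \<mu> \<in> pbw_span I S"
proof -
  have "r \<in> R" using RR_idealD(1)[OF assms(1)] assms(2) by blast
  then show ?thesis
    unfolding pbw_span_def using assms pbw_repr_monom[of r \<mu>] RR_idealD(2)[OF assms(1)]
    by (auto intro!: exI[of _ "\<lambda>\<nu>. if \<nu> = \<mu> then r else \<zero>"] split: if_splits)
qed

text \<open>Additive statements about a span reduce to single terms. The set \<open>I\<close> is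
  arbitrary here, so the case \<open>monom\<close> provides \<open>r \<in> R\<close> besides
  \<open>r \<in> I\<close>.\<close>

lemma pbw_span_induct [consumes 1, case_names zero monom add]:
  assumes a: "a \<in> pbw_span I S"
    and zero: "P \<zero>"
    and monom: "\<And>r \<mu>. \<lbrakk> r \<in> I; r \<in> R; \<mu> \<in> S; \<mu> \<in> exponents n \<rbrakk> \<Longrightarrow> P (r \<otimes> mon \<mu>)"
    and add: "\<And>a b. \<lbrakk> a \<in> carrier A; b \<in> carrier A; P a; P b \<rbrakk> \<Longrightarrow> P (a \<oplus> b)"
  shows "P a"
proof -
  obtain c where c: "pbw_repr a c" "\<And>\<mu>. c \<mu> \<in> I" "\<And>\<mu>. c \<mu> \<noteq> \<zero> \<Longrightarrow> \<mu> \<in> S"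
    using a unfolding pbw_span_def by auto
  note cl = pbw_repr_closed[OF c(1)]
  \<comment> \<open>Only subsets of the support are summed: where \<open>c\<close> vanishes, the
    exponent need not lie in \<open>S\<close>.\<close>
  have "P (\<Oplus>\<mu>\<in>F. c \<mu> \<otimes> mon \<mu>)" if "finite F" "F \<subseteq> {\<mu>. c \<mu> \<noteq> \<zero>}" for F
    using that
  proof (induction F)
    case (insert \<mu> F)
    have "\<mu> \<in> exponents n" using insert.prems pbw_repr_support(2)[OF c(1)] by blast
    then have "P (c \<mu> \<otimes> mon \<mu>)" using insert.prems c cl by (intro monom) auto
    moreover have "(\<Oplus>\<mu>\<in>F. c \<mu> \<otimes> mon \<mu>) \<in> carrier A" by (rule finsum_closed) (use cl in auto)
    ultimately have "P (c \<mu> \<otimes> mon \<mu> \<oplus> (\<Oplus>\<mu>\<in>F. c \<mu> \<otimes> mon \<mu>))"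
      using insert cl by (intro add) auto
    moreover have "(\<Oplus>\<mu>\<in>insert \<mu> F. c \<mu> \<otimes> mon \<mu>) = c \<mu> \<otimes> mon \<mu> \<oplus> (\<Oplus>\<mu>\<in>F. c \<mu> \<otimes> mon \<mu>)"
      by (rule finsum_insert) (use insert cl in auto)
    ultimately show ?case by simp
  qed (use zero in simp)
  then show ?thesis
    using pbw_repr_expand[OF c(1) pbw_repr_support(1)[OF c(1)]] pbw_repr_support(1)[OF c(1)] by simp
qed

section \<open>Exponents, total degree and units of the coefficient ring\<close>

abbreviation deg :: "(nat \<Rightarrow> nat) \<Rightarrow> nat"
  where "deg \<alpha> \<equiv> (\<Sum>i=1..n. \<alpha> i)"

abbreviation lower :: "nat \<Rightarrow> 'a set"
  where "lower d \<equiv> pbw_span R {\<kappa>. deg \<kappa> < d}"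

lemma deg_add: "deg (\<alpha> + \<beta>) = deg \<alpha> + deg \<beta>"
  by (simp add: sum.distrib)

lemma deg_unit: "i \<in> {1..n} \<Longrightarrow> deg (unit_exp i) = 1"
  by (simp add: sum.delta)

lemma exponents_add: "\<lbrakk> \<alpha> \<in> exponents n; \<beta> \<in> exponents n \<rbrakk> \<Longrightarrow> \<alpha> + \<beta> \<in> exponents n"
  by (simp add: exponents_def)

lemma exponents_unit: "i \<in> {1..n} \<Longrightarrow> unit_exp i \<in> exponents n"
  by (auto simp: exponents_def)

lemma mon_unit: "i \<in> {1..n} \<Longrightarrow> mon (unit_exp i) = x i"
  using monom_unit[of n i] by simp

text \<open>The least index with a nonzero exponent is taken, so the split removes the leftmost
  variable of the monomial, and \<open>\<beta>\<close> satisfies the hypothesis of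
  \<open>var_monom_min\<close>. The bound \<open>j \<le> k\<close> lets the caller compare
  \<open>j\<close> with an index of its own.\<close>

lemma exponent_split_min:
  assumes \<alpha>: "\<alpha> \<in> exponents n" and k: "\<alpha> k \<noteq> 0"
  shows "\<exists>j\<in>{1..n}. \<exists>\<beta>\<in>exponents n. j \<le> k \<and> \<alpha> = \<beta> + unit_exp j \<and> (\<forall>k<j. \<beta> k = 0) \<and>
    deg \<alpha> = Suc (deg \<beta>)"
proof -
  define j where "j = (LEAST k. \<alpha> k \<noteq> 0)"
  define \<beta> where "\<beta> = \<alpha>(j := \<alpha> j - 1)"
  have j: "\<alpha> j \<noteq> 0" unfolding j_def using k by (rule LeastI)
  have jk: "j \<le> k" unfolding j_def using k by (rule Least_le)
  have "\<forall>i. i \<notin> {1..n} \<longrightarrow> \<alpha> i = 0" using \<alpha> unfolding exponents_def by (rule CollectD)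
  then have jn: "j \<in> {1..n}" using j by (metis (no_types))
  have eq: "\<alpha> = \<beta> + unit_exp j" using j by (auto simp: \<beta>_def fun_eq_iff)
  have \<beta>: "\<beta> \<in> exponents n" using \<alpha> by (auto simp: \<beta>_def exponents_def)
  have min: "\<beta> k = 0" if "k < j" for k
    using not_less_Least[of k "\<lambda>k. \<alpha> k \<noteq> 0"] that by (simp add: j_def \<beta>_def)
  have "deg \<alpha> = deg \<beta> + deg (unit_exp j)" unfolding eq by (rule deg_add)
  then have d: "deg \<alpha> = Suc (deg \<beta>)" using deg_unit[OF jn] by simp
  show ?thesis using jn jk \<beta> eq min d by blast
qed

text \<open>All factors of the monomial before the \<open>i\<close>-th are \<open>\<one>\<close>, so
  \<open>x i\<close> already stands in its place and no commutation takes place.\<close>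

lemma var_monom_min:
  assumes i: "i \<in> {1..n}" and min: "\<And>k. k < i \<Longrightarrow> \<alpha> k = 0"
  shows "x i \<otimes> mon \<alpha> = mon (\<alpha> + unit_exp i)"
proof -
  \<comment> \<open>Both partial products are \<open>\<one>\<close> before the \<open>i\<close>-th
    factor; from there on they differ by a left factor \<open>x i\<close>. Both facts are carried
    through the induction.\<close>
  have "pbw_monom A x (\<alpha> + unit_exp i) m = (if i \<le> m then x i \<otimes> pbw_monom A x \<alpha> m else \<one>) \<and>
      (m < i \<longrightarrow> pbw_monom A x \<alpha> m = \<one>)" if "m \<le> n" for m
    using that
  proof (induction m)
    case 0
    then show ?case using i by simp
  next
    case (Suc m)
    have cl: "x (Suc m) \<in> carrier A" "x i \<in> carrier A" "pbw_monom A x \<alpha> m \<in> carrier A"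
      using Suc.prems i monom_closed by simp_all
    consider "Suc m < i" | "Suc m = i" | "i \<le> m" by linarith
    then show ?case
    proof cases
      case 1
      then show ?thesis using Suc min[of "Suc m"] by simp
    next
      case 2
      then have "i = Suc m" by simp
      then show ?thesis using Suc cl by (simp add: nat_pow_Suc2[symmetric])
    next
      case 3
      then show ?thesis using Suc cl by (simp add: m_assoc)
    qed
  qed
  from this[of n] i show ?thesis by simp
qed

lemma Units_RR: "u \<in> Units RR \<longleftrightarrow> u \<in> R \<and> (\<exists>v\<in>R. v \<otimes> u = \<one> \<and> u \<otimes> v = \<one>)"
  by (auto simp: Units_def)

lemma Units_RR_closed: "u \<in> Units RR \<Longrightarrow> u \<in> R"
  by (simp add: Units_RR)

lemma Units_RR_mult: "\<lbrakk> u \<in> Units RR; v \<in> Units RR \<rbrakk> \<Longrightarrow> u \<otimes> v \<in> Units RR"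
  using monoid.Units_m_closed[OF ring.is_monoid[OF RR_ring], of u v] by simp

lemma Units_RR_one: "\<one> \<in> Units RR"
  by (auto simp: Units_RR)

lemma sigma_closed: "\<lbrakk> i \<in> {1..n}; r \<in> R \<rbrakk> \<Longrightarrow> \<sigma> i r \<in> R"
  by (rule var_commute(2))

lemma sigma_one: "i \<in> {1..n} \<Longrightarrow> \<sigma> i \<one> = \<one>"
  using ring_hom_one[OF sigma_ring_hom] by simp

lemma sigma_Units:
  assumes i: "i \<in> {1..n}" and u: "u \<in> Units RR"
  shows "\<sigma> i u \<in> Units RR"
proof -
  obtain v where "u \<in> R" "v \<in> R" "v \<otimes> u = \<one>" "u \<otimes> v = \<one>" using u by (auto simp: Units_RR)
  then have "\<sigma> i v \<otimes> \<sigma> i u = \<one>" "\<sigma> i u \<otimes> \<sigma> i v = \<one>"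
    using sigma_delta_mult(1)[OF i] sigma_one[OF i] by metis+
  then show ?thesis unfolding Units_RR using sigma_closed[OF i] \<open>u \<in> R\<close> \<open>v \<in> R\<close> by blast
qed

lemma pbw_linear_closed:
  assumes "p \<in> pbw_linear A R n x"
  shows "p \<in> carrier A"
proof -
  obtain r s where "r \<in> R" "s \<in> {1..n} \<rightarrow> R" and p: "p = r \<oplus> (\<Oplus>k\<in>{1..n}. s k \<otimes> x k)"
    using assms unfolding pbw_linear_def by blast
  moreover have "(\<Oplus>k\<in>{1..n}. s k \<otimes> x k) \<in> carrier A"
    by (rule finsum_closed) (use \<open>s \<in> {1..n} \<rightarrow> R\<close> in \<open>auto simp: Pi_iff\<close>)
  ultimately show ?thesis by simp
qed

text \<open>Meant for error terms, whose coefficients are unknown elements of \<open>R\<close>: the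
  factor \<open>r\<close> alone forces the result to have coefficients in \<open>I\<close>.\<close>

lemma pbw_span_smult_ideal:
  assumes I: "ideal I RR" and r: "r \<in> I" and a: "a \<in> pbw_span R S"
  shows "r \<otimes> a \<in> pbw_span I S"
proof -
  have rc: "r \<in> R" using RR_idealD(1)[OF I] r by blast
  show ?thesis using a
  proof (induction a rule: pbw_span_induct)
    case zero
    then show ?case using rc pbw_span_zero[OF I] by simp
  next
    case (monom s \<mu>)
    then show ?case
      using rc pbw_span_monom[OF I RR_idealD(5)[OF I r], of s \<mu> S] by (simp add: m_assoc)
  next
    case (add a b)
    then show ?case using rc pbw_span_add[OF I] by (simp add: r_distr)
  qed
qed

section \<open>The degree-lexicographic order\<close>

text \<open>The degree decides first because products of monomials are controlled only up to terms
  of lower degree, which must count as smaller. Ties are broken by \<open>less_fun\<close>, that is,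
  at the first index where the exponents differ.\<close>

definition deglex :: "(nat \<Rightarrow> nat) \<Rightarrow> (nat \<Rightarrow> nat) \<Rightarrow> bool"
  where "deglex \<alpha> \<beta> \<longleftrightarrow> deg \<alpha> < deg \<beta> \<or> deg \<alpha> = deg \<beta> \<and> less_fun \<alpha> \<beta>"

abbreviation tail :: "(nat \<Rightarrow> nat) \<Rightarrow> 'a set"
  where "tail \<gamma> \<equiv> pbw_span R {\<kappa>. deglex \<kappa> \<gamma>}"

lemma deglex_irrefl: "\<not> deglex \<alpha> \<alpha>"
  by (simp add: deglex_def less_fun_irrefl)

lemma deglex_trans: "\<lbrakk> deglex \<alpha> \<beta>; deglex \<beta> \<gamma> \<rbrakk> \<Longrightarrow> deglex \<alpha> \<gamma>"
  unfolding deglex_def using less_fun_trans[of \<alpha> \<beta> \<gamma>] by linarith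

lemma deglex_deg: "deglex \<alpha> \<beta> \<Longrightarrow> deg \<alpha> \<le> deg \<beta>"
  unfolding deglex_def by linarith

lemma deglex_add_right: "deglex \<alpha> \<beta> \<Longrightarrow> deglex (\<alpha> + \<gamma>) (\<beta> + \<gamma>)"
  unfolding deglex_def deg_add less_fun_def by auto

lemma deglex_add_left: "deglex \<alpha> \<beta> \<Longrightarrow> deglex (\<gamma> + \<alpha>) (\<gamma> + \<beta>)"
  using deglex_add_right[of \<alpha> \<beta> \<gamma>] by (simp add: add.commute)

lemma deglex_total:
  assumes "\<alpha> \<in> exponents n" "\<beta> \<in> exponents n" "\<alpha> \<noteq> \<beta>"
  shows "deglex \<alpha> \<beta> \<or> deglex \<beta> \<alpha>"
proof -
  have "\<alpha> k = \<beta> k" if "k \<notin> {1..n}" for k using assms(1,2) that by (simp add: exponents_def)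
  then have "{k. \<alpha> k \<noteq> \<beta> k} \<subseteq> {1..n}" by blast
  \<comment> \<open>The trichotomy of \<open>less_fun\<close> applies to functions that differ at
    finitely many places.\<close>
  then have "finite {k. \<alpha> k \<noteq> \<beta> k}" using finite_subset by blast
  then show ?thesis unfolding deglex_def using less_fun_trichotomy[of \<alpha> \<beta>] assms(3) by linarith
qed

lemma deglex_max:
  assumes "finite S" "S \<noteq> {}" "S \<subseteq> exponents n"
  shows "\<exists>m\<in>S. \<forall>s\<in>S. s \<noteq> m \<longrightarrow> deglex s m"
  using assms
proof (induction rule: finite_ne_induct)
  case (insert a S)
  then obtain m where m: "m \<in> S" "\<And>s. \<lbrakk> s \<in> S; s \<noteq> m \<rbrakk> \<Longrightarrow> deglex s m" by auto
  have "deglex a m \<or> deglex m a" using deglex_total[of a m] insert.prems insert.hyps m(1) by blast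
  then show ?case
  proof
    assume "deglex a m"
    then show ?thesis using m by blast
  next
    assume "deglex m a"
    then have "deglex s a" if "s \<in> S" for s using m(2)[OF that] deglex_trans by blast
    then show ?thesis by blast
  qed
qed simp

section \<open>Leading coefficients\<close>

lemma RR_idealI:
  assumes sub: "L \<subseteq> R" and ne: "L \<noteq> {}"
    and add: "\<And>c d. \<lbrakk> c \<in> L; d \<in> L \<rbrakk> \<Longrightarrow> c \<oplus> d \<in> L"
    and l: "\<And>r c. \<lbrakk> r \<in> R; c \<in> L \<rbrakk> \<Longrightarrow> r \<otimes> c \<in> L"
    and r: "\<And>r c. \<lbrakk> r \<in> R; c \<in> L \<rbrakk> \<Longrightarrow> c \<otimes> r \<in> L"
  shows "ideal L RR"
proof -
  interpret S: ring RR by (rule RR_ring)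
  show ?thesis
  proof (rule idealI[OF RR_ring])
    show "subgroup L (add_monoid RR)"
    proof (rule S.add.subgroupI)
      fix c assume c: "c \<in> L"
      then have cR: "c \<in> carrier RR" using sub by auto
      \<comment> \<open>Negation is multiplication by the negative of the unit, so closure under it
        follows from \<open>l\<close>.\<close>
      have "\<ominus>\<^bsub>RR\<^esub> c = (\<ominus>\<^bsub>RR\<^esub> \<one>\<^bsub>RR\<^esub>) \<otimes>\<^bsub>RR\<^esub> c"
        using S.l_minus[OF S.one_closed cR] S.l_one[OF cR] by simp
      also have "\<dots> \<in> L" using l[OF _ c] S.a_inv_closed[OF S.one_closed] by simp
      finally show "\<ominus>\<^bsub>RR\<^esub> c \<in> L" .
    qed (use sub ne add in auto)
  qed (use l r in auto)
qed

text \<open>The coefficient \<open>c\<close> may be zero, in which case \<open>\<alpha>\<close> is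
  no true leading exponent. This spares all case distinctions when leading terms cancel or a product
  of coefficients vanishes.\<close>

definition lead_coeffs :: "'a set \<Rightarrow> 'a set"
  where "lead_coeffs J = {c \<in> R. \<exists>\<alpha>\<in>exponents n. \<exists>t\<in>tail \<alpha>. c \<otimes> mon \<alpha> \<oplus> t \<in> J}"

lemma lead_coeffsI:
  "\<lbrakk> c \<in> R; \<alpha> \<in> exponents n; t \<in> tail \<alpha>; c \<otimes> mon \<alpha> \<oplus> t \<in> J \<rbrakk> \<Longrightarrow> c \<in> lead_coeffs J"
  unfolding lead_coeffs_def by blast

lemma lead_coeffsE:
  assumes "c \<in> lead_coeffs J"
  obtains \<alpha> t where "c \<in> R" "\<alpha> \<in> exponents n" "t \<in> tail \<alpha>" "c \<otimes> mon \<alpha> \<oplus> t \<in> J"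
  using assms unfolding lead_coeffs_def by blast

text \<open>Every exponent of the tail is strictly smaller than \<open>\<gamma>\<close>, so by
  uniqueness the coefficient of the whole element at \<open>\<gamma>\<close> is exactly
  \<open>c\<close>.\<close>

lemma lead_coeff_in_span:
  assumes c: "c \<in> R" and \<gamma>: "\<gamma> \<in> exponents n" and t: "t \<in> tail \<gamma>"
    and mem: "c \<otimes> mon \<gamma> \<oplus> t \<in> pbw_span I S"
  shows "c \<in> I"
proof -
  obtain e where e: "pbw_repr t e" "\<And>\<mu>. e \<mu> \<noteq> \<zero> \<Longrightarrow> deglex \<mu> \<gamma>"
    using t unfolding pbw_span_def by auto
  obtain f where f: "pbw_repr (c \<otimes> mon \<gamma> \<oplus> t) f" "\<And>\<mu>. f \<mu> \<in> I"
    using mem unfolding pbw_span_def by auto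
  have "f = (\<lambda>\<mu>. (if \<mu> = \<gamma> then c else \<zero>) \<oplus> e \<mu>)"
    by (rule pbw_repr_unique[OF f(1) pbw_repr_add[OF pbw_repr_monom[OF c \<gamma>] e(1)]])
  moreover have "e \<gamma> = \<zero>" using e(2)[of \<gamma>] deglex_irrefl[of \<gamma>] by blast
  ultimately have "f \<gamma> = c" using c by simp
  then show ?thesis using f(2)[of \<gamma>] by simp
qed

text \<open>An element of \<open>R\<close> is a leading form with exponent zero and zero tail, the
  monomial being \<open>\<one>\<close>.\<close>

lemma coeff_in_span:
  assumes "r \<in> R" "ideal I RR"
  shows "r \<in> pbw_span I (exponents n) \<longleftrightarrow> r \<in> I"
proof -
  have z: "(\<lambda>k. 0) \<in> exponents n" by (simp add: exponents_def)
  have m: "mon (\<lambda>k. 0) = \<one>" by (rule monom_zero)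
  show ?thesis
    using lead_coeff_in_span[OF assms(1) z pbw_span_zero[OF RR_ideal], of I "exponents n"]
      pbw_span_monom[OF assms(2) _ z z, of r] assms(1) by (auto simp: m)
qed

text \<open>The tail comes with its representation, which is \<open>c\<close> with the leading entry
  erased; its smaller support drives the induction in \<open>span_of_lead_coeffs\<close>.\<close>

lemma pbw_leading_term:
  assumes a: "pbw_repr a c" and ne: "{\<mu>. c \<mu> \<noteq> \<zero>} \<noteq> {}"
  obtains m t where "m \<in> exponents n" "c m \<noteq> \<zero>" "t \<in> tail m" "a = c m \<otimes> mon m \<oplus> t"
    "pbw_repr t (c(m := \<zero>))"
proof -
  let ?S = "{\<mu>. c \<mu> \<noteq> \<zero>}"
  note cl = pbw_repr_closed[OF a]
  have sub: "?S \<subseteq> exponents n" using pbw_repr_support(2)[OF a] by blast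
  have fin: "finite ?S" by (rule pbw_repr_support(1)[OF a])
  obtain m where m: "c m \<noteq> \<zero>" "\<And>s. \<lbrakk> c s \<noteq> \<zero>; s \<noteq> m \<rbrakk> \<Longrightarrow> deglex s m"
    using deglex_max[OF fin ne sub] by auto
  define t where "t = (\<Oplus>\<mu>\<in>?S - {m}. (c(m := \<zero>)) \<mu> \<otimes> mon \<mu>)"
  have t: "pbw_repr t (c(m := \<zero>))"
    by (rule pbw_reprI[OF _ _ _ _ t_def]) (use fin sub cl in auto)
  have "a = (\<Oplus>\<mu>\<in>insert m (?S - {m}). c \<mu> \<otimes> mon \<mu>)"
    by (rule pbw_repr_expand[OF a]) (use fin in auto)
  also have "\<dots> = c m \<otimes> mon m \<oplus> (\<Oplus>\<mu>\<in>?S - {m}. c \<mu> \<otimes> mon \<mu>)"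
    by (rule finsum_insert) (use fin cl in auto)
  also have "(\<Oplus>\<mu>\<in>?S - {m}. c \<mu> \<otimes> mon \<mu>) = t"
    unfolding t_def by (rule finsum_cong') (use cl in auto)
  finally have eq: "a = c m \<otimes> mon m \<oplus> t" .
  have "t \<in> tail m"
    unfolding pbw_span_def using t cl m(2)
    by (auto intro!: exI[of _ "c(m := \<zero>)"] split: if_splits)
  then show thesis using that[of m t] m(1) sub eq t by blast
qed

text \<open>Induction on the number of nonzero coefficients. The leading coefficient lies in
  \<open>I\<close>, so the leading term lies in the span and, by the hypothesis \<open>span\<close>,
  in \<open>J\<close>. Hence the tail is again in \<open>J\<close> and has fewer terms.\<close>

lemma span_of_lead_coeffs:
  assumes J: "ideal J A" and I: "ideal I RR" and sub: "lead_coeffs J \<subseteq> I"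
    and span: "pbw_span I (exponents n) \<subseteq> J"
  shows "J \<subseteq> pbw_span I (exponents n)"
proof
  interpret J: ideal J A by (rule J)
  fix a assume "a \<in> J"
  then obtain c where "pbw_repr a c" using pbw_repr_exists J.Icarr by blast
  then show "a \<in> pbw_span I (exponents n)"
    using \<open>a \<in> J\<close>
  proof (induction "card {\<mu>. c \<mu> \<noteq> \<zero>}" arbitrary: a c rule: less_induct)
    case less
    show ?case
    proof (cases "{\<mu>. c \<mu> \<noteq> \<zero>} = {}")
      case True
      then have "a = \<zero>" using pbw_repr_expand[OF less.prems(1), of "{}"] by simp
      then show ?thesis using pbw_span_zero[OF I] by simp
    next
      case False
      obtain m t where m: "m \<in> exponents n" "c m \<noteq> \<zero>" and t: "t \<in> tail m" "pbw_repr t (c(m := \<zero>))"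
        and a: "a = c m \<otimes> mon m \<oplus> t"
        using pbw_leading_term[OF less.prems(1) False] by metis
      have cm: "c m \<in> R" by (rule pbw_repr_closed(2)[OF less.prems(1)])
      have "c m \<in> lead_coeffs J" using lead_coeffsI[OF cm m(1) t(1)] less.prems(2) a by simp
      then have top: "c m \<otimes> mon m \<in> pbw_span I (exponents n)"
        using sub m(1) by (intro pbw_span_monom[OF I]) auto
      have tc: "t \<in> carrier A" using pbw_span_closed[OF t(1)] .
      have "t = a \<oplus> \<ominus> (c m \<otimes> mon m)"
      proof -
        have "q = (p \<oplus> q) \<oplus> \<ominus> p" if "p \<in> carrier A" "q \<in> carrier A" for p q using that by algebra
        then show ?thesis unfolding a using cm tc by simp
      qed
      then have tJ: "t \<in> J" using less.prems(2) top span J.a_closed J.a_inv_closed by auto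
      have "{\<mu>. (c(m := \<zero>)) \<mu> \<noteq> \<zero>} \<subset> {\<mu>. c \<mu> \<noteq> \<zero>}" using m(2) by auto
      then have "card {\<mu>. (c(m := \<zero>)) \<mu> \<noteq> \<zero>} < card {\<mu>. c \<mu> \<noteq> \<zero>}"
        using pbw_repr_support(1)[OF less.prems(1)] by (rule psubset_card_mono[rotated])
      then have "t \<in> pbw_span I (exponents n)" using less.hyps t(2) tJ by blast
      then show ?thesis unfolding a using pbw_span_add[OF I top] by blast
    qed
  qed
qed

abbreviation Sigma_ideal :: "'a set \<Rightarrow> bool"
  where "Sigma_ideal \<equiv> invariant_ideal RR (pbw_Sigma A R n x)"

lemma Sigma_ideal_iff:
  "Sigma_ideal I \<longleftrightarrow> ideal I RR \<and> (\<forall>i\<in>{1..n}. \<sigma> i ` I \<subseteq> I)"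
  by (auto simp: invariant_ideal_def pbw_Sigma_def)

lemma Sigma_idealD:
  "Sigma_ideal I \<Longrightarrow> ideal I RR" "\<lbrakk> Sigma_ideal I; i \<in> {1..n} \<rbrakk> \<Longrightarrow> \<sigma> i ` I \<subseteq> I"
  by (simp_all add: Sigma_ideal_iff)

end

section \<open>Products of monomials up to terms of lower degree\<close>

locale bijective_aut_skew_PBW_extension = skew_PBW_extension +
  assumes bijective: "pbw_bijective A R n x"
    and automorphism_type: "pbw_automorphism_type A R n x"
begin

lemma var_mult: "\<lbrakk> i \<in> {1..n}; r \<in> R \<rbrakk> \<Longrightarrow> x i \<otimes> r = \<sigma> i r \<otimes> x i"
  using var_commute(1,2) automorphism_type by (simp add: pbw_automorphism_type_def)

lemma var_swap:
  assumes ij: "i \<in> {1..n}" "j \<in> {1..n}" "i < j"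
  obtains c l where "c \<in> Units RR" "l \<in> pbw_linear A R n x" "x j \<otimes> x i = c \<otimes> (x i \<otimes> x j) \<oplus> l"
proof -
  obtain c where c: "c \<in> R - {\<zero>}" "x j \<otimes> x i \<ominus> c \<otimes> (x i \<otimes> x j) \<in> pbw_linear A R n x"
    using var_var[OF ij(1,2)] by blast
  \<comment> \<open>By uniqueness the \<open>c\<close> just obtained is the coefficient that
    bijectivity declares invertible.\<close>
  then have "pbw_coeff A R n x i j = c" using ij by (intro coeff_unique) auto
  then have "c \<in> Units RR" using bijective ij by (auto simp: pbw_bijective_def)
  moreover have "x j \<otimes> x i = c \<otimes> (x i \<otimes> x j) \<oplus> (x j \<otimes> x i \<ominus> c \<otimes> (x i \<otimes> x j))"
  proof -
    have "p = q \<oplus> (p \<ominus> q)" if "p \<in> carrier A" "q \<in> carrier A" for p q using that by algebra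
    then show ?thesis using ij c by simp
  qed
  ultimately show thesis using that c by blast
qed

text \<open>Named so that the next three lemmas can assume it for given exponents only: they are
  applied inside the induction that proves it in general.\<close>

abbreviation var_leads :: "nat \<Rightarrow> (nat \<Rightarrow> nat) \<Rightarrow> bool"
  where "var_leads i \<alpha> \<equiv> \<exists>u\<in>Units RR. \<exists>l\<in>lower (Suc (deg \<alpha>)).
    x i \<otimes> mon \<alpha> = u \<otimes> mon (\<alpha> + unit_exp i) \<oplus> l"

lemma var_leads_span:
  assumes i: "i \<in> {1..n}" and \<alpha>: "\<alpha> \<in> exponents n" and lead: "var_leads i \<alpha>"
    and d: "deg \<alpha> < d"
  shows "x i \<otimes> mon \<alpha> \<in> lower (Suc d)"
proof -
  obtain u l where u: "u \<in> Units RR" and l: "l \<in> lower (Suc (deg \<alpha>))"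
    and eq: "x i \<otimes> mon \<alpha> = u \<otimes> mon (\<alpha> + unit_exp i) \<oplus> l" using lead by blast
  have "deg (\<alpha> + unit_exp i) < Suc d" using d i by (simp only: deg_add deg_unit)
  then have "u \<otimes> mon (\<alpha> + unit_exp i) \<in> lower (Suc d)"
    using exponents_add[OF \<alpha> exponents_unit[OF i]] Units_RR_closed[OF u]
    by (intro pbw_span_monom[OF RR_ideal]) auto
  moreover have "l \<in> lower (Suc d)"
    by (rule subsetD[OF pbw_span_mono l]) (use d in auto)
  ultimately show ?thesis unfolding eq by (rule pbw_span_add[OF RR_ideal])
qed

text \<open>Passing \<open>x i\<close> through a coefficient only replaces \<open>r\<close> by
  \<open>\<sigma> i r\<close>, since the derivations vanish; the degree grows by at most
  one.\<close>

lemma var_lower: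
  assumes i: "i \<in> {1..n}"
    and lead: "\<And>\<alpha>. \<lbrakk> \<alpha> \<in> exponents n; deg \<alpha> < d \<rbrakk> \<Longrightarrow> var_leads i \<alpha>"
    and a: "a \<in> lower d"
  shows "x i \<otimes> a \<in> lower (Suc d)"
  using a
proof (induction a rule: pbw_span_induct)
  case zero
  then show ?case using i pbw_span_zero[OF RR_ideal] by simp
next
  case (monom r \<mu>)
  have "x i \<otimes> (r \<otimes> mon \<mu>) = \<sigma> i r \<otimes> (x i \<otimes> mon \<mu>)"
    using i monom sigma_closed[OF i] by (simp add: m_assoc[symmetric] var_mult)
  moreover have "\<dots> \<in> lower (Suc d)"
  proof (rule pbw_span_smult[OF RR_ideal sigma_closed[OF i monom(2)] var_leads_span[OF i monom(4)]])
    show "deg \<mu> < d" using monom(3) by (rule CollectD)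
    then show "var_leads i \<mu>" by (rule lead[OF monom(4)])
  qed
  ultimately show ?case by simp
next
  case (add a b)
  then show ?case using i pbw_span_add[OF RR_ideal] by (simp add: r_distr)
qed

text \<open>The linear factor has degree at most one, so the product has degree at most
  \<open>deg \<beta> + 1\<close>. In \<open>var_monom\<close> this is one less than the degree of
  the leading monomial.\<close>

lemma linear_lower:
  assumes p: "p \<in> pbw_linear A R n x" and \<beta>: "\<beta> \<in> exponents n"
    and lead: "\<And>k. k \<in> {1..n} \<Longrightarrow> var_leads k \<beta>"
  shows "p \<otimes> mon \<beta> \<in> lower (Suc (Suc (deg \<beta>)))"
proof -
  let ?V = "lower (Suc (Suc (deg \<beta>)))"
  obtain r s where rs: "r \<in> R" "s \<in> {1..n} \<rightarrow> R" and p: "p = r \<oplus> (\<Oplus>k\<in>{1..n}. s k \<otimes> x k)"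
    using p unfolding pbw_linear_def by blast
  have s: "s k \<in> R" if "k \<in> {1..n}" for k using rs that by blast
  have sum: "(\<Oplus>k\<in>G. s k \<otimes> x k) \<in> carrier A" if "G \<subseteq> {1..n}" for G
    by (rule finsum_closed) (use s that in auto)
  have "(\<Oplus>k\<in>G. s k \<otimes> x k) \<otimes> mon \<beta> \<in> ?V" if "finite G" "G \<subseteq> {1..n}" for G
    using that
  proof (induction G)
    case empty
    then show ?case using pbw_span_zero[OF RR_ideal] by simp
  next
    case (insert k G)
    then have k: "k \<in> {1..n}" and G: "G \<subseteq> {1..n}" by auto
    have xk: "x k \<in> carrier A" using k by simp
    have "(\<Oplus>k\<in>insert k G. s k \<otimes> x k) = s k \<otimes> x k \<oplus> (\<Oplus>k\<in>G. s k \<otimes> x k)"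
      by (rule finsum_insert) (use insert k G s in auto)
    then have eq: "(\<Oplus>k\<in>insert k G. s k \<otimes> x k) \<otimes> mon \<beta> =
        s k \<otimes> (x k \<otimes> mon \<beta>) \<oplus> (\<Oplus>k\<in>G. s k \<otimes> x k) \<otimes> mon \<beta>"
      using sum[OF G] xk s[OF k] by (simp add: l_distr m_assoc)
    have "s k \<otimes> (x k \<otimes> mon \<beta>) \<in> ?V"
      using pbw_span_smult[OF RR_ideal s[OF k] var_leads_span[OF k \<beta> lead[OF k]], of "Suc (deg \<beta>)"]
      by simp
    then show ?case unfolding eq using insert.IH[OF G] by (rule pbw_span_add[OF RR_ideal])
  qed
  then have "(\<Oplus>k\<in>{1..n}. s k \<otimes> x k) \<otimes> mon \<beta> \<in> ?V" by simp
  moreover have "r \<otimes> mon \<beta> \<in> ?V" using rs \<beta> by (intro pbw_span_monom[OF RR_ideal]) auto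
  moreover have "p \<otimes> mon \<beta> = r \<otimes> mon \<beta> \<oplus> (\<Oplus>k\<in>{1..n}. s k \<otimes> x k) \<otimes> mon \<beta>"
    unfolding p using rs sum[of "{1..n}"] by (simp add: l_distr)
  ultimately show ?thesis by (simp only: pbw_span_add[OF RR_ideal])
qed

text \<open>Moving \<open>x\<^sub>i\<close> past a smaller first variable \<open>x\<^sub>j\<close> of the monomial costs a unit and
  a linear error term, and lowers the degree of the monomial still to be passed.\<close>

lemma var_monom:
  assumes "i \<in> {1..n}" "\<alpha> \<in> exponents n"
  shows "var_leads i \<alpha>"
  using assms
proof (induction "deg \<alpha>" arbitrary: i \<alpha> rule: less_induct)
  case less
  note i = less.prems(1) and \<alpha> = less.prems(2)
  show ?case
  proof (cases "\<forall>k<i. \<alpha> k = 0")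
    case True
    then have "x i \<otimes> mon \<alpha> = \<one> \<otimes> mon (\<alpha> + unit_exp i) \<oplus> \<zero>"
      using var_monom_min[OF i, of \<alpha>] by simp
    then show ?thesis using Units_RR_one pbw_span_zero[OF RR_ideal] by blast
  next
    case False
    then obtain k where k: "k < i" "\<alpha> k \<noteq> 0" by blast
    obtain j \<beta> where j: "j \<in> {1..n}" "j \<le> k" and \<beta>: "\<beta> \<in> exponents n" "\<alpha> = \<beta> + unit_exp j"
      and min: "\<And>k. k < j \<Longrightarrow> \<beta> k = 0" and deg: "deg \<alpha> = Suc (deg \<beta>)"
      using exponent_split_min[OF \<alpha> k(2)] by blast
    have ji: "j < i" using j k by simp
    \<comment> \<open>The induction hypothesis is used for three kinds of variables:
      \<open>x i\<close> in front of \<open>mon \<beta>\<close>, \<open>x j\<close> in front of the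
      error \<open>l\<close>, and all variables in the linear error \<open>p\<close>.\<close>
    have lead: "var_leads k \<gamma>" if "k \<in> {1..n}" "\<gamma> \<in> exponents n" "deg \<gamma> < deg \<alpha>" for k \<gamma>
      using less.hyps that by blast
    obtain c p where c: "c \<in> Units RR" and p: "p \<in> pbw_linear A R n x"
      and swap: "x i \<otimes> x j = c \<otimes> (x j \<otimes> x i) \<oplus> p" using var_swap[OF j(1) i ji] by blast
    obtain u l where u: "u \<in> Units RR" and l: "l \<in> lower (Suc (deg \<beta>))"
      and eq: "x i \<otimes> mon \<beta> = u \<otimes> mon (\<beta> + unit_exp i) \<oplus> l"
      using lead[OF i \<beta>(1)] deg by auto
    have pV: "p \<otimes> mon \<beta> \<in> lower (Suc (deg \<alpha>))"
      unfolding deg by (rule linear_lower[OF p \<beta>(1)]) (use lead \<beta> deg in simp)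
    have lV: "x j \<otimes> l \<in> lower (Suc (deg \<alpha>))"
      unfolding deg by (rule var_lower[OF j(1) _ l]) (use lead deg j in simp)
    \<comment> \<open>Since \<open>j < i\<close>, adding \<open>x i\<close> leaves
      \<open>x j\<close> in front of all variables that occur, so \<open>x j\<close> joins the
      monomial without a further swap.\<close>
    have top: "x j \<otimes> mon (\<beta> + unit_exp i) = mon (\<alpha> + unit_exp i)"
    proof -
      have "x j \<otimes> mon (\<beta> + unit_exp i) = mon (\<beta> + unit_exp i + unit_exp j)"
        by (rule var_monom_min[OF j(1)]) (use min ji in simp)
      also have "\<beta> + unit_exp i + unit_exp j = \<alpha> + unit_exp i" using \<beta> by (auto simp: fun_eq_iff)
      finally show ?thesis .
    qed
    have cl: "x i \<in> carrier A" "x j \<in> carrier A" "c \<in> carrier A" "u \<in> carrier A"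
      "l \<in> carrier A" "\<sigma> j u \<in> carrier A"
      using i j Units_RR_closed[OF c] Units_RR_closed[OF u] pbw_span_closed[OF l]
        sigma_closed[OF j(1)] by auto
    have pc: "p \<in> carrier A" by (rule pbw_linear_closed[OF p])
    have "x i \<otimes> mon \<alpha> = (x i \<otimes> x j) \<otimes> mon \<beta>"
      using var_monom_min[OF j(1) min] \<beta> cl by (simp add: m_assoc)
    also have "\<dots> = c \<otimes> (x j \<otimes> (x i \<otimes> mon \<beta>)) \<oplus> p \<otimes> mon \<beta>"
      unfolding swap using cl pc by (simp add: l_distr m_assoc)
    also have "x j \<otimes> (x i \<otimes> mon \<beta>) = (x j \<otimes> u) \<otimes> mon (\<beta> + unit_exp i) \<oplus> x j \<otimes> l"
      unfolding eq using cl by (simp add: r_distr m_assoc)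
    also have "(x j \<otimes> u) \<otimes> mon (\<beta> + unit_exp i) = \<sigma> j u \<otimes> mon (\<alpha> + unit_exp i)"
      unfolding top[symmetric] var_mult[OF j(1) Units_RR_closed[OF u]] using cl by (simp add: m_assoc)
    also have "c \<otimes> (\<sigma> j u \<otimes> mon (\<alpha> + unit_exp i) \<oplus> x j \<otimes> l) \<oplus> p \<otimes> mon \<beta> =
        (c \<otimes> \<sigma> j u) \<otimes> mon (\<alpha> + unit_exp i) \<oplus> (c \<otimes> (x j \<otimes> l) \<oplus> p \<otimes> mon \<beta>)"
      using cl pc by (simp add: r_distr m_assoc a_assoc)
    finally have "x i \<otimes> mon \<alpha> =
        (c \<otimes> \<sigma> j u) \<otimes> mon (\<alpha> + unit_exp i) \<oplus> (c \<otimes> (x j \<otimes> l) \<oplus> p \<otimes> mon \<beta>)" .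
    moreover have "c \<otimes> \<sigma> j u \<in> Units RR" by (rule Units_RR_mult[OF c sigma_Units[OF j(1) u]])
    moreover have "c \<otimes> (x j \<otimes> l) \<oplus> p \<otimes> mon \<beta> \<in> lower (Suc (deg \<alpha>))"
      using pbw_span_add[OF RR_ideal pbw_span_smult[OF RR_ideal Units_RR_closed[OF c] lV] pV] .
    ultimately show ?thesis by blast
  qed
qed

text \<open>Induction on the degree of \<open>\<mu>\<close>: its leftmost variable is set aside and
  then put in front of the product of the rest by \<open>var_monom\<close>. The factors stay units
  because each \<open>\<sigma> j\<close> preserves units.\<close>

lemma monom_mult:
  assumes "\<mu> \<in> exponents n" and \<nu>: "\<nu> \<in> exponents n"
  obtains u l where "u \<in> Units RR" "l \<in> lower (deg \<mu> + deg \<nu>)"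
    "mon \<mu> \<otimes> mon \<nu> = u \<otimes> mon (\<mu> + \<nu>) \<oplus> l"
proof -
  have "\<exists>u\<in>Units RR. \<exists>l\<in>lower (deg \<mu> + deg \<nu>). mon \<mu> \<otimes> mon \<nu> = u \<otimes> mon (\<mu> + \<nu>) \<oplus> l"
    using assms(1)
  proof (induction "deg \<mu>" arbitrary: \<mu>)
    case 0
    then have "\<mu> = (\<lambda>k. 0)" by (auto simp: exponents_def fun_eq_iff)
    then have "mon \<mu> \<otimes> mon \<nu> = \<one> \<otimes> mon (\<mu> + \<nu>) \<oplus> \<zero>"
      using monom_zero by (simp add: plus_fun_def)
    then show ?case using Units_RR_one pbw_span_zero[OF RR_ideal] by blast
  next
    case (Suc d)
    then have "\<exists>k. \<mu> k \<noteq> 0" by (metis sum.neutral nat.distinct(1))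
    then obtain k where k: "\<mu> k \<noteq> 0" ..
    obtain j \<beta> where j: "j \<in> {1..n}" and "j \<le> k" and \<beta>: "\<beta> \<in> exponents n" "\<mu> = \<beta> + unit_exp j"
      and min: "\<And>k. k < j \<Longrightarrow> \<beta> k = 0" and deg: "deg \<mu> = Suc (deg \<beta>)"
      using exponent_split_min[OF Suc.prems k] by blast
    obtain u l where u: "u \<in> Units RR" and l: "l \<in> lower (deg \<beta> + deg \<nu>)"
      and eq: "mon \<beta> \<otimes> mon \<nu> = u \<otimes> mon (\<beta> + \<nu>) \<oplus> l"
      using Suc.hyps(1)[of \<beta>] Suc.hyps(2) \<beta> deg by auto
    obtain v l' where v: "v \<in> Units RR" and l': "l' \<in> lower (Suc (deg (\<beta> + \<nu>)))"
      and eq': "x j \<otimes> mon (\<beta> + \<nu>) = v \<otimes> mon (\<beta> + \<nu> + unit_exp j) \<oplus> l'"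
      using var_monom[OF j exponents_add[OF \<beta>(1) \<nu>]] by blast
    have ex: "\<beta> + \<nu> + unit_exp j = \<mu> + \<nu>" using \<beta> by (auto simp: fun_eq_iff)
    have dd: "Suc (deg (\<beta> + \<nu>)) = deg \<mu> + deg \<nu>" unfolding deg deg_add by simp
    have l1: "x j \<otimes> l \<in> lower (deg \<mu> + deg \<nu>)"
      unfolding deg using var_lower[OF j var_monom[OF j] l] by simp
    have cl: "x j \<in> carrier A" "u \<in> carrier A" "v \<in> carrier A" "\<sigma> j u \<in> carrier A"
      "l \<in> carrier A" "l' \<in> carrier A"
      using j Units_RR_closed[OF u] Units_RR_closed[OF v] pbw_span_closed[OF l]
        pbw_span_closed[OF l'] sigma_closed[OF j] by auto
    have "mon \<mu> \<otimes> mon \<nu> = x j \<otimes> (mon \<beta> \<otimes> mon \<nu>)"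
      using var_monom_min[OF j min] \<beta> cl by (simp add: m_assoc[symmetric])
    also have "\<dots> = (x j \<otimes> u) \<otimes> mon (\<beta> + \<nu>) \<oplus> x j \<otimes> l"
      unfolding eq using cl by (simp add: r_distr m_assoc)
    also have "(x j \<otimes> u) \<otimes> mon (\<beta> + \<nu>) = \<sigma> j u \<otimes> (x j \<otimes> mon (\<beta> + \<nu>))"
      unfolding var_mult[OF j Units_RR_closed[OF u]] using cl by (simp add: m_assoc)
    also have "\<dots> \<oplus> x j \<otimes> l = (\<sigma> j u \<otimes> v) \<otimes> mon (\<mu> + \<nu>) \<oplus> (\<sigma> j u \<otimes> l' \<oplus> x j \<otimes> l)"
      unfolding eq' ex using cl by (simp add: r_distr m_assoc a_assoc)
    finally have "mon \<mu> \<otimes> mon \<nu> =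
      (\<sigma> j u \<otimes> v) \<otimes> mon (\<mu> + \<nu>) \<oplus> (\<sigma> j u \<otimes> l' \<oplus> x j \<otimes> l)" .
    moreover have "\<sigma> j u \<otimes> v \<in> Units RR" by (rule Units_RR_mult[OF sigma_Units[OF j u] v])
    moreover have "\<sigma> j u \<otimes> l' \<oplus> x j \<otimes> l \<in> lower (deg \<mu> + deg \<nu>)"
      using pbw_span_add[OF RR_ideal pbw_span_smult[OF RR_ideal _ l'[unfolded dd]] l1]
        Units_RR_closed[OF sigma_Units[OF j u]] by blast
    ultimately show ?case by blast
  qed
  then show thesis using that by blast
qed

section \<open>Moving coefficients past monomials\<close>

text \<open>Passing through \<open>mon \<alpha>\<close> applies a composite of powers of the maps
  \<open>\<sigma> i\<close>. Only the membership of the result in \<open>J\<close> is recorded, not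
  the composite itself.\<close>

lemma monom_twist:
  assumes J: "J \<subseteq> R" "\<And>i. i \<in> {1..n} \<Longrightarrow> \<sigma> i ` J \<subseteq> J" and "r \<in> J"
  obtains r' where "r' \<in> J" "mon \<alpha> \<otimes> r = r' \<otimes> mon \<alpha>"
proof -
  have pow: "\<exists>r'\<in>J. x i [^] (k::nat) \<otimes> r = r' \<otimes> x i [^] k" if i: "i \<in> {1..n}" and r: "r \<in> J" for i k r
    using r
  proof (induction k arbitrary: r)
    case 0
    then show ?case using J by (auto intro!: bexI[of _ r])
  next
    case (Suc k)
    have "\<sigma> i r \<in> J" using J(2)[OF i] Suc.prems by blast
    then obtain r' where r': "r' \<in> J" "x i [^] k \<otimes> \<sigma> i r = r' \<otimes> x i [^] k" using Suc.IH by blast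
    have cl: "x i \<in> carrier A" "r \<in> R" "r' \<in> R" using i r' Suc.prems J by auto
    have "x i [^] Suc k \<otimes> r = x i [^] k \<otimes> (x i \<otimes> r)" using cl by (simp add: m_assoc)
    also have "\<dots> = (x i [^] k \<otimes> \<sigma> i r) \<otimes> x i"
      using cl sigma_closed[OF i] by (simp add: m_assoc var_mult[OF i])
    also have "\<dots> = r' \<otimes> x i [^] Suc k" unfolding r'(2) using cl by (simp add: m_assoc)
    finally show ?case using r' by blast
  qed
  have "\<exists>r'\<in>J. pbw_monom A x \<alpha> m \<otimes> r = r' \<otimes> pbw_monom A x \<alpha> m" if "m \<le> n" "r \<in> J" for m r
    using that
  proof (induction m arbitrary: r)
    case 0
    then show ?case using J by (auto intro!: bexI[of _ r])
  next
    case (Suc m)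
    have i: "Suc m \<in> {1..n}" using Suc.prems by simp
    let ?p = "x (Suc m) [^] \<alpha> (Suc m)"
    \<comment> \<open>The last factor meets the coefficient first, so the induction hypothesis is
      applied to \<open>s\<close> rather than \<open>r\<close>.\<close>
    obtain s where s: "s \<in> J" "?p \<otimes> r = s \<otimes> ?p" using pow[OF i Suc.prems(2)] by blast
    obtain r' where r': "r' \<in> J" "pbw_monom A x \<alpha> m \<otimes> s = r' \<otimes> pbw_monom A x \<alpha> m"
      using Suc s by fastforce
    have cl: "?p \<in> carrier A" "pbw_monom A x \<alpha> m \<in> carrier A" "r \<in> R" "s \<in> R" "r' \<in> R"
      using i r' s Suc.prems J monom_closed[of m] by auto
    have "pbw_monom A x \<alpha> (Suc m) \<otimes> r = (pbw_monom A x \<alpha> m \<otimes> s) \<otimes> ?p"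
      using cl s by (simp add: m_assoc)
    also have "\<dots> = r' \<otimes> pbw_monom A x \<alpha> (Suc m)" unfolding r'(2) using cl by (simp add: m_assoc)
    finally show ?case using r' by blast
  qed
  from this[of n r] assms(3) that show thesis by blast
qed

text \<open>The converse of \<open>monom_twist\<close>: a coefficient on the left is carried to the
  right through successive preimages under the maps \<open>\<sigma> i\<close>, which the inclusion
  of \<open>J\<close> in its images provides within \<open>J\<close>.\<close>

lemma monom_untwist:
  assumes J: "J \<subseteq> R" "\<And>i. i \<in> {1..n} \<Longrightarrow> J \<subseteq> \<sigma> i ` J" and "r \<in> J"
  obtains r' where "r' \<in> J" "mon \<alpha> \<otimes> r' = r \<otimes> mon \<alpha>"
proof -
  have pow: "\<exists>r'\<in>J. x i [^] (k::nat) \<otimes> r' = r \<otimes> x i [^] k" if i: "i \<in> {1..n}" and r: "r \<in> J" for i k r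
    using r
  proof (induction k arbitrary: r)
    case 0
    then show ?case using J by (auto intro!: bexI[of _ r])
  next
    case (Suc k)
    obtain s where s: "s \<in> J" "x i [^] k \<otimes> s = r \<otimes> x i [^] k" using Suc by blast
    obtain r' where r': "r' \<in> J" "s = \<sigma> i r'" using J(2)[OF i] s by blast
    have cl: "x i \<in> carrier A" "r \<in> R" "r' \<in> R" "s \<in> R" using i r' s Suc.prems J by auto
    have "x i [^] Suc k \<otimes> r' = x i [^] k \<otimes> (x i \<otimes> r')" using cl by (simp add: m_assoc)
    also have "\<dots> = (x i [^] k \<otimes> s) \<otimes> x i"
      using cl by (simp add: m_assoc var_mult[OF i] r'(2)[symmetric])
    also have "\<dots> = r \<otimes> x i [^] Suc k" unfolding s(2) using cl by (simp add: m_assoc)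
    finally show ?case using r' by blast
  qed
  have "\<exists>r'\<in>J. pbw_monom A x \<alpha> m \<otimes> r' = r \<otimes> pbw_monom A x \<alpha> m" if "m \<le> n" "r \<in> J" for m r
    using that
  proof (induction m arbitrary: r)
    case 0
    then show ?case using J by (auto intro!: bexI[of _ r])
  next
    case (Suc m)
    have i: "Suc m \<in> {1..n}" using Suc.prems by simp
    let ?p = "x (Suc m) [^] \<alpha> (Suc m)"
    \<comment> \<open>In contrast to \<open>monom_twist\<close>, the first factors are passed before
      the last one.\<close>
    obtain s where s: "s \<in> J" "pbw_monom A x \<alpha> m \<otimes> s = r \<otimes> pbw_monom A x \<alpha> m"
      using Suc by fastforce
    obtain r' where r': "r' \<in> J" "?p \<otimes> r' = s \<otimes> ?p" using pow[OF i s(1)] by blast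
    have cl: "?p \<in> carrier A" "pbw_monom A x \<alpha> m \<in> carrier A" "r \<in> R" "s \<in> R" "r' \<in> R"
      using i r' s Suc.prems J monom_closed[of m] by auto
    have "pbw_monom A x \<alpha> (Suc m) \<otimes> r' = (pbw_monom A x \<alpha> m \<otimes> s) \<otimes> ?p"
      using cl r' by (simp add: m_assoc)
    also have "\<dots> = r \<otimes> pbw_monom A x \<alpha> (Suc m)" unfolding s(2) using cl by (simp add: m_assoc)
    finally show ?case using r' by blast
  qed
  from this[of n r] assms(3) that show thesis by blast
qed

section \<open>Products of spans and of leading forms\<close>

text \<open>Coefficients of \<open>b\<close> must pass the monomials of \<open>a\<close>, hence the
  invariance of \<open>I'\<close>. A product of monomials has an uncontrolled error of lower degree,
  hence \<open>Q\<close> contains, with each sum of exponents, everything of smaller degree. The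
  generality serves ideals, products of ideals and tails alike.\<close>

lemma pbw_span_mult:
  assumes a: "a \<in> pbw_span I S" and b: "b \<in> pbw_span I' S'"
    and J: "ideal J RR" and IJ: "\<And>r s. \<lbrakk> r \<in> I; s \<in> I' \<rbrakk> \<Longrightarrow> r \<otimes> s \<in> J"
    and I': "I' \<subseteq> R" "\<And>i. i \<in> {1..n} \<Longrightarrow> \<sigma> i ` I' \<subseteq> I'"
    and Q: "\<And>\<mu> \<nu>. \<lbrakk> \<mu> \<in> S; \<nu> \<in> S' \<rbrakk> \<Longrightarrow> \<mu> + \<nu> \<in> Q \<and> {\<kappa>. deg \<kappa> < deg \<mu> + deg \<nu>} \<subseteq> Q"
  shows "a \<otimes> b \<in> pbw_span J Q"
  using a
proof (induction a rule: pbw_span_induct)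
  case zero
  then show ?case using pbw_span_zero[OF J] pbw_span_closed[OF b] by simp
next
  case (add a a')
  then show ?case using pbw_span_add[OF J] pbw_span_closed[OF b] by (simp add: l_distr)
next
  case (monom r \<mu>)
  note r = monom
  show ?case using b
  proof (induction b rule: pbw_span_induct)
    case zero
    then show ?case using pbw_span_zero[OF J] r by simp
  next
    case (add b b')
    then show ?case using pbw_span_add[OF J] r by (simp add: r_distr)
  next
    case (monom s \<nu>)
    obtain s' where s': "s' \<in> I'" "mon \<mu> \<otimes> s = s' \<otimes> mon \<mu>"
      using monom_twist[OF I' monom(1)] by blast
    have s'R: "s' \<in> R" using s' I' by blast
    obtain u l where u: "u \<in> Units RR" and l: "l \<in> lower (deg \<mu> + deg \<nu>)"
      and eq: "mon \<mu> \<otimes> mon \<nu> = u \<otimes> mon (\<mu> + \<nu>) \<oplus> l"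
      using monom_mult[OF r(4) monom(4)] by blast
    have uR: "u \<in> R" using Units_RR_closed[OF u] .
    have rs: "r \<otimes> s' \<in> J" using IJ[OF r(1) s'(1)] .
    have lc: "l \<in> carrier A" using pbw_span_closed[OF l] .
    have Q': "\<mu> + \<nu> \<in> Q" "{\<kappa>. deg \<kappa> < deg \<mu> + deg \<nu>} \<subseteq> Q" using Q[OF r(3) monom(3)] by auto
    have "(r \<otimes> mon \<mu>) \<otimes> (s \<otimes> mon \<nu>) = r \<otimes> (mon \<mu> \<otimes> s) \<otimes> mon \<nu>"
      using r monom by (simp add: m_assoc)
    also have "\<dots> = (r \<otimes> s') \<otimes> (mon \<mu> \<otimes> mon \<nu>)"
      unfolding s'(2) using r s'R by (simp add: m_assoc)
    also have "\<dots> = (r \<otimes> s' \<otimes> u) \<otimes> mon (\<mu> + \<nu>) \<oplus> (r \<otimes> s') \<otimes> l"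
      unfolding eq using r s'R uR lc by (simp add: m_assoc r_distr)
    also have "\<dots> \<in> pbw_span J Q"
    proof (rule pbw_span_add[OF J])
      show "(r \<otimes> s' \<otimes> u) \<otimes> mon (\<mu> + \<nu>) \<in> pbw_span J Q"
        by (rule pbw_span_monom[OF J RR_idealD(5)[OF J rs uR] Q'(1) exponents_add[OF r(4) monom(4)]])
      show "(r \<otimes> s') \<otimes> l \<in> pbw_span J Q"
        by (rule pbw_span_smult_ideal[OF J rs subsetD[OF pbw_span_mono[OF order_refl Q'(2)] l]])
    qed
    finally show ?case .
  qed
qed

text \<open>The hypothesis \<open>ne\<close> excludes the one pair of exponents whose sum is
  \<open>\<alpha> + \<beta>\<close> by taking both leading exponents; every other pair has a
  strictly smaller sum.\<close>

lemma tail_mult: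
  assumes a: "a \<in> pbw_span R S" and b: "b \<in> pbw_span R S'"
    and S: "\<And>\<mu>. \<mu> \<in> S \<Longrightarrow> \<mu> = \<alpha> \<or> deglex \<mu> \<alpha>" and S': "\<And>\<nu>. \<nu> \<in> S' \<Longrightarrow> \<nu> = \<beta> \<or> deglex \<nu> \<beta>"
    and ne: "\<alpha> \<notin> S \<or> \<beta> \<notin> S'"
  shows "a \<otimes> b \<in> tail (\<alpha> + \<beta>)"
proof (rule pbw_span_mult[OF a b RR_ideal])
  fix \<mu> \<nu> assume mem: "\<mu> \<in> S" "\<nu> \<in> S'"
  have less: "deglex (\<mu> + \<nu>) (\<alpha> + \<beta>)"
    using S[OF mem(1)] S'[OF mem(2)] ne mem
      deglex_add_right[of \<mu> \<alpha> \<nu>] deglex_add_left[of \<nu> \<beta> \<alpha>] deglex_trans[of "\<mu> + \<nu>" "\<alpha> + \<nu>" "\<alpha> + \<beta>"]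
    by metis
  have "deg \<mu> + deg \<nu> \<le> deg (\<alpha> + \<beta>)" using deglex_deg[OF less] unfolding deg_add .
  then have "{\<kappa>. deg \<kappa> < deg \<mu> + deg \<nu>} \<subseteq> {\<kappa>. deglex \<kappa> (\<alpha> + \<beta>)}"
    unfolding deglex_def by auto
  then show "\<mu> + \<nu> \<in> {\<kappa>. deglex \<kappa> (\<alpha> + \<beta>)} \<and>
      {\<kappa>. deg \<kappa> < deg \<mu> + deg \<nu>} \<subseteq> {\<kappa>. deglex \<kappa> (\<alpha> + \<beta>)}" using less by blast
qed (use sigma_closed in auto)

text \<open>The twisted coefficient \<open>d'\<close> is a parameter because its origin varies: it
  is \<open>\<one>\<close> when shifting an exponent, \<open>\<sigma> i c\<close> for a single
  variable, and a prescribed value when \<open>d\<close> is found by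
  \<open>monom_untwist\<close>.\<close>

lemma leading_mult:
  assumes \<alpha>: "\<alpha> \<in> exponents n" and \<beta>: "\<beta> \<in> exponents n"
    and c: "c \<in> R" and d: "d \<in> R" "d' \<in> R" "mon \<alpha> \<otimes> d = d' \<otimes> mon \<alpha>"
    and t: "t \<in> tail \<alpha>" and s: "s \<in> tail \<beta>"
  obtains u t' where "u \<in> Units RR" "t' \<in> tail (\<alpha> + \<beta>)"
    "(c \<otimes> mon \<alpha> \<oplus> t) \<otimes> (d \<otimes> mon \<beta> \<oplus> s) = (c \<otimes> d' \<otimes> u) \<otimes> mon (\<alpha> + \<beta>) \<oplus> t'"
proof -
  obtain u l where u: "u \<in> Units RR" and l: "l \<in> lower (deg \<alpha> + deg \<beta>)"
    and eq: "mon \<alpha> \<otimes> mon \<beta> = u \<otimes> mon (\<alpha> + \<beta>) \<oplus> l"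
    using monom_mult[OF \<alpha> \<beta>] by blast
  have cl: "c \<in> carrier A" "d \<in> carrier A" "d' \<in> carrier A" "t \<in> carrier A" "s \<in> carrier A"
    "l \<in> carrier A" "u \<in> carrier A"
    using c d pbw_span_closed t s l Units_RR_closed[OF u] by auto
  have "lower (deg \<alpha> + deg \<beta>) \<subseteq> tail (\<alpha> + \<beta>)"
    by (rule pbw_span_mono[OF order_refl]) (auto simp: deglex_def sum.distrib)
  then have l': "(c \<otimes> d') \<otimes> l \<in> tail (\<alpha> + \<beta>)"
    using l c d by (intro pbw_span_smult[OF RR_ideal]) auto
  have top: "c \<otimes> mon \<alpha> \<in> pbw_span R {\<alpha>}" "d \<otimes> mon \<beta> \<in> pbw_span R {\<beta>}"
    using pbw_span_monom[OF RR_ideal] c d \<alpha> \<beta> by simp_all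
  \<comment> \<open>In each of the remaining three products at least one factor is a tail, so the
    leading exponents never meet.\<close>
  have 1: "(c \<otimes> mon \<alpha>) \<otimes> s \<in> tail (\<alpha> + \<beta>)"
    by (rule tail_mult[OF top(1) s]) (auto simp: deglex_irrefl)
  have 2: "t \<otimes> (d \<otimes> mon \<beta>) \<in> tail (\<alpha> + \<beta>)"
    by (rule tail_mult[OF t top(2)]) (auto simp: deglex_irrefl)
  have 3: "t \<otimes> s \<in> tail (\<alpha> + \<beta>)"
    by (rule tail_mult[OF t s]) (auto simp: deglex_irrefl)
  have "(c \<otimes> mon \<alpha>) \<otimes> (d \<otimes> mon \<beta>) = c \<otimes> (mon \<alpha> \<otimes> d) \<otimes> mon \<beta>"
    using cl by (simp add: m_assoc)
  also have "\<dots> = (c \<otimes> d') \<otimes> (mon \<alpha> \<otimes> mon \<beta>)" unfolding d(3) using cl by (simp add: m_assoc)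
  also have "\<dots> = (c \<otimes> d' \<otimes> u) \<otimes> mon (\<alpha> + \<beta>) \<oplus> (c \<otimes> d') \<otimes> l"
    unfolding eq using cl by (simp add: r_distr m_assoc)
  finally have main: "(c \<otimes> mon \<alpha>) \<otimes> (d \<otimes> mon \<beta>) =
      (c \<otimes> d' \<otimes> u) \<otimes> mon (\<alpha> + \<beta>) \<oplus> (c \<otimes> d') \<otimes> l" .
  have "(c \<otimes> mon \<alpha> \<oplus> t) \<otimes> (d \<otimes> mon \<beta> \<oplus> s) =
      (c \<otimes> mon \<alpha>) \<otimes> (d \<otimes> mon \<beta>) \<oplus> ((c \<otimes> mon \<alpha>) \<otimes> s \<oplus> (t \<otimes> (d \<otimes> mon \<beta>) \<oplus> t \<otimes> s))"
    using cl by (simp add: l_distr r_distr a_ac)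
  also have "\<dots> = (c \<otimes> d' \<otimes> u) \<otimes> mon (\<alpha> + \<beta>) \<oplus>
      ((c \<otimes> d') \<otimes> l \<oplus> ((c \<otimes> mon \<alpha>) \<otimes> s \<oplus> (t \<otimes> (d \<otimes> mon \<beta>) \<oplus> t \<otimes> s)))"
    unfolding main using cl by (simp add: a_assoc)
  finally show thesis
    using that[OF u] pbw_span_add[OF RR_ideal] l' 1 2 3 by metis
qed

section \<open>The extensions IA and AI\<close>

lemma pbw_span_ideal:
  assumes inv: "Sigma_ideal I"
  shows "ideal (pbw_span I (exponents n)) A"
proof (rule idealI[OF ring_axioms])
  note I = Sigma_idealD(1)[OF inv]
  note D = RR_idealD[OF I]
  show "subgroup (pbw_span I (exponents n)) (add_monoid A)"
  proof (rule add.subgroupI)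
    show "pbw_span I (exponents n) \<noteq> {}" using pbw_span_zero[OF I] by blast
  qed (use pbw_span_closed pbw_span_add[OF I] pbw_span_uminus[OF I] in auto)
  \<comment> \<open>Taking \<open>UNIV\<close> as the set of exponents makes the condition on
    exponents in \<open>pbw_span_mult\<close> trivial.\<close>
  have Q: "pbw_span I UNIV = pbw_span I (exponents n)"
    unfolding pbw_span_def using pbw_repr_support(2) by blast
  fix a b assume a: "a \<in> pbw_span I (exponents n)" and b: "b \<in> carrier A"
  have b': "b \<in> pbw_span R (exponents n)" using b pbw_span_all by simp
  \<comment> \<open>On this side the coefficients from \<open>I\<close> pass the monomials of
    \<open>b\<close>, which calls for the invariance of \<open>I\<close>; on the other side
    coefficients from \<open>R\<close> are the ones that move.\<close>
  show "b \<otimes> a \<in> pbw_span I (exponents n)"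
    unfolding Q[symmetric] by (rule pbw_span_mult[OF b' a I D(4) D(1) Sigma_idealD(2)[OF inv]]) auto
  show "a \<otimes> b \<in> pbw_span I (exponents n)"
    unfolding Q[symmetric]
    by (rule pbw_span_mult[OF a b' I D(5) order_refl]) (use sigma_closed in auto)
qed

lemma right_extension_eq:
  assumes inv: "Sigma_ideal I"
  shows "right_extension A I = pbw_span I (exponents n)"
proof
  note I = Sigma_idealD(1)[OF inv]
  interpret P: ideal "pbw_span I (exponents n)" A by (rule pbw_span_ideal[OF inv])
  show "right_extension A I \<subseteq> pbw_span I (exponents n)"
  proof
    fix a assume "a \<in> right_extension A I"
    then show "a \<in> pbw_span I (exponents n)"
      unfolding right_extension_def
    proof (induction a rule: ideal_prod.induct)
      case (prod r a)
      then have "r \<in> pbw_span I (exponents n)" using coeff_in_span I RR_idealD(1)[OF I] by blast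
      then show ?case using prod P.I_r_closed by blast
    next
      case (sum a b)
      then show ?case using pbw_span_add[OF I] by blast
    qed
  qed
  show "pbw_span I (exponents n) \<subseteq> right_extension A I"
  proof
    fix a assume "a \<in> pbw_span I (exponents n)"
    then show "a \<in> right_extension A I"
      unfolding right_extension_def
    proof (induction a rule: pbw_span_induct)
      case zero
      \<comment> \<open>The extension is generated by products and sums, so zero enters as a product
        of zeros.\<close>
      then show ?case using ideal_prod.prod[OF RR_idealD(2)[OF I] zero_closed, of A] by simp
    next
      case (monom r \<mu>)
      then show ?case by (intro ideal_prod.prod) auto
    next
      case (add a b)
      then show ?case by (intro ideal_prod.sum)
    qed
  qed
qed

text \<open>A term \<open>r \<otimes> mon \<mu>\<close> must be rewritten as
  \<open>mon \<mu> \<otimes> r'\<close> with \<open>r'\<close> in \<open>I\<close>. This takes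
  preimages within \<open>I\<close>, hence equality with the image instead of mere
  invariance.\<close>

lemma left_extension_eq:
  assumes I: "ideal I RR" and inv: "\<forall>i\<in>{1..n}. \<sigma> i ` I = I"
  shows "left_extension A I = pbw_span I (exponents n)"
proof
  interpret P: ideal "pbw_span I (exponents n)" A
    by (rule pbw_span_ideal) (use I inv in \<open>simp add: Sigma_ideal_iff\<close>)
  show "left_extension A I \<subseteq> pbw_span I (exponents n)"
  proof
    fix a assume "a \<in> left_extension A I"
    then show "a \<in> pbw_span I (exponents n)"
      unfolding left_extension_def
    proof (induction a rule: ideal_prod.induct)
      case (prod a r)
      then have "r \<in> pbw_span I (exponents n)" using coeff_in_span I RR_idealD(1)[OF I] by blast
      then show ?case using prod P.I_l_closed by blast
    next
      case (sum a b)
      then show ?case using pbw_span_add[OF I] by blast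
    qed
  qed
  show "pbw_span I (exponents n) \<subseteq> left_extension A I"
  proof
    fix a assume "a \<in> pbw_span I (exponents n)"
    then show "a \<in> left_extension A I"
      unfolding left_extension_def
    proof (induction a rule: pbw_span_induct)
      case zero
      then show ?case using ideal_prod.prod[OF zero_closed RR_idealD(2)[OF I], of A] by simp
    next
      case (monom r \<mu>)
      obtain r' where r': "r' \<in> I" "mon \<mu> \<otimes> r' = r \<otimes> mon \<mu>"
        using monom_untwist[OF RR_idealD(1)[OF I] _ monom(1)] inv by blast
      show ?case unfolding r'(2)[symmetric] using r'(1) by (intro ideal_prod.prod) auto
    next
      case (add a b)
      then show ?case by (intro ideal_prod.sum)
    qed
  qed
qed

lemma right_extension_Int:
  assumes inv: "Sigma_ideal I"
  shows "right_extension A I \<inter> R = I"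
  unfolding right_extension_eq[OF inv]
  using coeff_in_span[OF _ Sigma_idealD(1)[OF inv]] RR_idealD(1)[OF Sigma_idealD(1)[OF inv]] by blast

section \<open>From a prime ideal IA to a Sigma-prime ideal I\<close>

lemma sigma_prime_if_prime:
  assumes inv: "Sigma_ideal I"
    and prime: "nc_prime_ideal A (right_extension A I)"
  shows "sigma_prime_ideal RR (pbw_Sigma A R n x) I"
proof -
  let ?P = "\<lambda>I. pbw_span I (exponents n)"
  note I = Sigma_idealD(1)[OF inv]
  have P: "nc_prime_ideal A (?P I)" using prime unfolding right_extension_eq[OF inv] .
  have "J \<subseteq> I \<or> K \<subseteq> I"
    if JK: "Sigma_ideal J" "Sigma_ideal K"
      and sub: "ideal_prod RR J K \<subseteq> I" for J K
  proof -
    note J = Sigma_idealD[OF JK(1)] and K = Sigma_idealD[OF JK(2)]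
    have rs: "r \<otimes> s \<in> I" if "r \<in> J" "s \<in> K" for r s
      using ideal_prod.prod[OF that, of RR] sub by auto
    have Q: "pbw_span I UNIV = ?P I" unfolding pbw_span_def using pbw_repr_support(2) by blast
    have "ideal_prod A (?P J) (?P K) \<subseteq> ?P I"
    proof
      fix a assume "a \<in> ideal_prod A (?P J) (?P K)"
      then show "a \<in> ?P I"
      proof (induction a rule: ideal_prod.induct)
        case (prod a b)
        have "a \<otimes> b \<in> pbw_span I UNIV"
          \<comment> \<open>The invariance of \<open>K\<close> keeps its coefficients in
            \<open>K\<close> while they pass the monomials of the left factor.\<close>
          by (rule pbw_span_mult[OF prod I rs RR_idealD(1)[OF K(1)] K(2)]) auto
        then show ?case unfolding Q .
      qed (rule pbw_span_add[OF I])
    qed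
    then have "?P J \<subseteq> ?P I \<or> ?P K \<subseteq> ?P I"
      using P pbw_span_ideal[OF JK(1)] pbw_span_ideal[OF JK(2)] unfolding nc_prime_ideal_def by blast
    \<comment> \<open>An inclusion of spans restricts to the elements of \<open>R\<close>, which
      returns the coefficient ideals.\<close>
    moreover have "M \<subseteq> I" if "ideal M RR" "?P M \<subseteq> ?P I" for M
      using that coeff_in_span[OF _ that(1)] coeff_in_span[OF _ I] RR_idealD(1)[OF that(1)] by blast
    ultimately show ?thesis using J(1) K(1) by blast
  qed
  moreover have "I \<noteq> R"
    using P pbw_span_all unfolding nc_prime_ideal_def by auto
  ultimately show ?thesis unfolding sigma_prime_ideal_def using inv by auto
qed

end

section \<open>Ideals of leading coefficients over a commutative Noetherian ring\<close>

locale noetherian_aut_skew_PBW_extension = bijective_aut_skew_PBW_extension +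
  assumes commutative: "cring RR" and noetherian: "noetherian_ring RR"
begin

lemma R_comm: "\<lbrakk> r \<in> R; s \<in> R \<rbrakk> \<Longrightarrow> r \<otimes> s = s \<otimes> r"
  using comm_monoid.m_comm[OF cring.axioms(2)[OF commutative], of r s] by simp

lemma sigma_image_ideal:
  assumes i: "i \<in> {1..n}" and L: "ideal L RR" and inv: "\<sigma> i ` L \<subseteq> L"
  shows "\<sigma> i ` L = L"
proof -
  have "\<sigma> i ` R = R"
    using automorphism_type i by (auto simp: pbw_automorphism_type_def bij_betw_def)
  then have "L \<subseteq> \<sigma> i ` L"
    by (intro noetherian_ring.ideal_subset_image[OF noetherian sigma_ring_hom[OF i] _ L inv]) simp
  then show ?thesis using inv by blast
qed

text \<open>The unit stands to the right of \<open>c\<close>, whereas its inverse is multiplied from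
  the left so as to act on coefficients only; commutativity of \<open>R\<close> brings the two
  together.\<close>

lemma leading_unit_cancel:
  assumes J: "ideal J A" and c: "c \<in> R" and u: "u \<in> Units RR" and t: "t \<in> tail \<gamma>"
    and mem: "(c \<otimes> u) \<otimes> mon \<gamma> \<oplus> t \<in> J"
  obtains t' where "t' \<in> tail \<gamma>" "c \<otimes> mon \<gamma> \<oplus> t' \<in> J"
proof -
  obtain v where v: "v \<in> R" "u \<in> R" "u \<otimes> v = \<one>" using u by (auto simp: Units_RR)
  have "v \<otimes> (c \<otimes> u) = c \<otimes> (u \<otimes> v)"
    using R_comm[of v "c \<otimes> u"] c v(1,2) by (simp add: m_assoc)
  then have vc: "v \<otimes> (c \<otimes> u) = c" using v c by simp
  have "v \<otimes> ((c \<otimes> u) \<otimes> mon \<gamma> \<oplus> t) = (v \<otimes> (c \<otimes> u)) \<otimes> mon \<gamma> \<oplus> v \<otimes> t"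
    using v c pbw_span_closed[OF t] by (simp add: r_distr m_assoc)
  also have "\<dots> = c \<otimes> mon \<gamma> \<oplus> v \<otimes> t" unfolding vc ..
  finally have "c \<otimes> mon \<gamma> \<oplus> v \<otimes> t \<in> J"
    using ideal.I_l_closed[OF J mem, of v] v by simp
  then show thesis using that pbw_span_smult[OF RR_ideal v(1) t] by blast
qed

text \<open>Right multiplication by \<open>mon \<gamma>\<close> changes the leading coefficient only
  by a unit, which is then cancelled. This brings leading forms to a common exponent.\<close>

lemma leading_shift:
  assumes J: "ideal J A" and c: "c \<in> R" and \<alpha>: "\<alpha> \<in> exponents n" and t: "t \<in> tail \<alpha>"
    and mem: "c \<otimes> mon \<alpha> \<oplus> t \<in> J" and \<gamma>: "\<gamma> \<in> exponents n"
  obtains t' where "t' \<in> tail (\<alpha> + \<gamma>)" "c \<otimes> mon (\<alpha> + \<gamma>) \<oplus> t' \<in> J"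
proof -
  obtain u t' where u: "u \<in> Units RR" and t': "t' \<in> tail (\<alpha> + \<gamma>)"
    and eq: "(c \<otimes> mon \<alpha> \<oplus> t) \<otimes> (\<one> \<otimes> mon \<gamma> \<oplus> \<zero>) = (c \<otimes> \<one> \<otimes> u) \<otimes> mon (\<alpha> + \<gamma>) \<oplus> t'"
    by (rule leading_mult[OF \<alpha> \<gamma> c R_ops(2) R_ops(2) _ t pbw_span_zero[OF RR_ideal]]) simp
  have "(c \<otimes> \<one> \<otimes> u) \<otimes> mon (\<alpha> + \<gamma>) \<oplus> t' \<in> J"
    unfolding eq[symmetric] using ideal.I_r_closed[OF J mem] by simp
  then show thesis
    using leading_unit_cancel[OF J c u t'] c that by auto
qed

text \<open>Left multiplication by \<open>x i\<close> applies \<open>\<sigma> i\<close> to the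
  leading coefficient, up to a unit.\<close>

lemma lead_coeffs_sigma:
  assumes J: "ideal J A" and i: "i \<in> {1..n}" and c: "c \<in> lead_coeffs J"
  shows "\<sigma> i c \<in> lead_coeffs J"
proof -
  obtain \<alpha> t where c: "c \<in> R" and \<alpha>: "\<alpha> \<in> exponents n" and t: "t \<in> tail \<alpha>"
    and mem: "c \<otimes> mon \<alpha> \<oplus> t \<in> J" using c by (rule lead_coeffsE)
  have xi: "x i \<in> carrier A" using i by simp
  have sc: "\<sigma> i c \<in> R" by (rule sigma_closed[OF i c])
  have tw: "mon (unit_exp i) \<otimes> c = \<sigma> i c \<otimes> mon (unit_exp i)"
    unfolding mon_unit[OF i] by (rule var_mult[OF i c])
  obtain u t' where u: "u \<in> Units RR" and t': "t' \<in> tail (unit_exp i + \<alpha>)"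
    and eq: "(\<one> \<otimes> mon (unit_exp i) \<oplus> \<zero>) \<otimes> (c \<otimes> mon \<alpha> \<oplus> t) =
      (\<one> \<otimes> \<sigma> i c \<otimes> u) \<otimes> mon (unit_exp i + \<alpha>) \<oplus> t'"
    by (rule leading_mult[OF exponents_unit[OF i] \<alpha> R_ops(2) c sc tw pbw_span_zero[OF RR_ideal] t])
  have "(\<one> \<otimes> \<sigma> i c \<otimes> u) \<otimes> mon (unit_exp i + \<alpha>) \<oplus> t' \<in> J"
    unfolding eq[symmetric] by (rule ideal.I_l_closed[OF J mem]) simp
  then have "(\<sigma> i c \<otimes> u) \<otimes> mon (unit_exp i + \<alpha>) \<oplus> t' \<in> J" using sc by simp
  then obtain t'' where "t'' \<in> tail (unit_exp i + \<alpha>)" "\<sigma> i c \<otimes> mon (unit_exp i + \<alpha>) \<oplus> t'' \<in> J"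
    by (rule leading_unit_cancel[OF J sc u t'])
  then show ?thesis by (rule lead_coeffsI[OF sc exponents_add[OF exponents_unit[OF i] \<alpha>]])
qed

lemma lead_coeffs_ideal:
  assumes J: "ideal J A"
  shows "ideal (lead_coeffs J) RR"
proof (rule RR_idealI)
  interpret J: ideal J A by (rule J)
  show "lead_coeffs J \<subseteq> R" by (auto simp: lead_coeffs_def)
  have "(\<lambda>k. 0) \<in> exponents n" by (simp add: exponents_def)
  then have "\<zero> \<in> lead_coeffs J"
    by (rule lead_coeffsI[OF R_ops(1) _ pbw_span_zero[OF RR_ideal]]) (simp add: additive_subgroup.zero_closed[OF J.additive_subgroup_axioms])
  then show "lead_coeffs J \<noteq> {}" by blast
  fix r c assume r: "r \<in> R" and c': "c \<in> lead_coeffs J"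
  obtain \<alpha> t where c: "c \<in> R" and \<alpha>: "\<alpha> \<in> exponents n" and t: "t \<in> tail \<alpha>"
    and mem: "c \<otimes> mon \<alpha> \<oplus> t \<in> J" using c' by (rule lead_coeffsE)
  have "r \<otimes> (c \<otimes> mon \<alpha> \<oplus> t) = (r \<otimes> c) \<otimes> mon \<alpha> \<oplus> r \<otimes> t"
    using r c pbw_span_closed[OF t] by (simp add: r_distr m_assoc)
  then have "(r \<otimes> c) \<otimes> mon \<alpha> \<oplus> r \<otimes> t \<in> J" using J.I_l_closed[OF mem, of r] r by simp
  then show "r \<otimes> c \<in> lead_coeffs J"
    using r c by (intro lead_coeffsI[OF _ \<alpha> pbw_span_smult[OF RR_ideal r t]]) auto
  then show "c \<otimes> r \<in> lead_coeffs J" using R_comm[OF r c] by simp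
next
  interpret J: ideal J A by (rule J)
  fix c d assume c': "c \<in> lead_coeffs J" and d': "d \<in> lead_coeffs J"
  obtain \<alpha> t where c: "c \<in> R" and \<alpha>: "\<alpha> \<in> exponents n" and t: "t \<in> tail \<alpha>"
    and mem: "c \<otimes> mon \<alpha> \<oplus> t \<in> J" using c' by (rule lead_coeffsE)
  obtain \<beta> s where d: "d \<in> R" and \<beta>: "\<beta> \<in> exponents n" and s: "s \<in> tail \<beta>"
    and mem': "d \<otimes> mon \<beta> \<oplus> s \<in> J" using d' by (rule lead_coeffsE)
  \<comment> \<open>Each form is shifted by the exponent of the other, so that both lead at
    \<open>\<alpha> + \<beta>\<close> and can be added.\<close>
  obtain t' where t': "t' \<in> tail (\<alpha> + \<beta>)" "c \<otimes> mon (\<alpha> + \<beta>) \<oplus> t' \<in> J"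
    by (rule leading_shift[OF J c \<alpha> t mem \<beta>])
  obtain s' where s': "s' \<in> tail (\<alpha> + \<beta>)" "d \<otimes> mon (\<alpha> + \<beta>) \<oplus> s' \<in> J"
    by (rule leading_shift[OF J d \<beta> s mem' \<alpha>, unfolded add.commute[of \<beta> \<alpha>]])
  have "(c \<otimes> mon (\<alpha> + \<beta>) \<oplus> t') \<oplus> (d \<otimes> mon (\<alpha> + \<beta>) \<oplus> s') =
      (c \<oplus> d) \<otimes> mon (\<alpha> + \<beta>) \<oplus> (t' \<oplus> s')"
    using c d pbw_span_closed[OF t'(1)] pbw_span_closed[OF s'(1)] by (simp add: l_distr a_ac)
  then have "(c \<oplus> d) \<otimes> mon (\<alpha> + \<beta>) \<oplus> (t' \<oplus> s') \<in> J"
    using J.a_closed[OF t'(2) s'(2)] by simp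
  then show "c \<oplus> d \<in> lead_coeffs J"
    using c d by (intro lead_coeffsI[OF _ exponents_add[OF \<alpha> \<beta>] pbw_span_add[OF RR_ideal t'(1) s'(1)]]) auto
qed

text \<open>Multiplying a form led by \<open>c\<close> at \<open>\<alpha>\<close> with one led by
  \<open>d\<close> would yield \<open>c\<close> times a twist of \<open>d\<close>. So
  \<open>d\<close> is replaced in advance by an \<open>e\<close> whose twist is \<open>d\<close>.
  This \<open>e\<close> is again a leading coefficient of \<open>K\<close>, as each
  \<open>\<sigma> i\<close> maps these onto themselves, and it brings its own exponent
  \<open>\<beta>\<close>.\<close>

lemma lead_coeffs_mult:
  assumes J: "ideal J A" and K: "ideal K A" and I: "ideal I RR"
    and JK: "ideal_prod A J K \<subseteq> pbw_span I (exponents n)"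
    and c: "c \<in> lead_coeffs J" and d: "d \<in> lead_coeffs K"
  shows "c \<otimes> d \<in> I"
proof -
  note L = lead_coeffs_ideal[OF K]
  obtain \<alpha> t where c: "c \<in> R" and \<alpha>: "\<alpha> \<in> exponents n" and t: "t \<in> tail \<alpha>"
    and mem: "c \<otimes> mon \<alpha> \<oplus> t \<in> J" using c by (rule lead_coeffsE)
  have "lead_coeffs K \<subseteq> \<sigma> i ` lead_coeffs K" if "i \<in> {1..n}" for i
    using sigma_image_ideal[OF that L] lead_coeffs_sigma[OF K that] by blast
  then obtain e where e: "e \<in> lead_coeffs K" "mon \<alpha> \<otimes> e = d \<otimes> mon \<alpha>"
    using monom_untwist[OF RR_idealD(1)[OF L] _ d] by blast
  obtain \<beta> s where eR: "e \<in> R" and \<beta>: "\<beta> \<in> exponents n" and s: "s \<in> tail \<beta>"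
    and mem': "e \<otimes> mon \<beta> \<oplus> s \<in> K" using e(1) by (rule lead_coeffsE)
  have dR: "d \<in> R" using d RR_idealD(1)[OF L] by blast
  obtain u t' where u: "u \<in> Units RR" and t': "t' \<in> tail (\<alpha> + \<beta>)"
    and eq: "(c \<otimes> mon \<alpha> \<oplus> t) \<otimes> (e \<otimes> mon \<beta> \<oplus> s) = (c \<otimes> d \<otimes> u) \<otimes> mon (\<alpha> + \<beta>) \<oplus> t'"
    by (rule leading_mult[OF \<alpha> \<beta> c eR dR e(2) t s])
  have prod: "(c \<otimes> d \<otimes> u) \<otimes> mon (\<alpha> + \<beta>) \<oplus> t' \<in> pbw_span I (exponents n)"
    unfolding eq[symmetric] using ideal_prod.prod[OF mem mem', of A] JK by blast
  have "c \<otimes> d \<otimes> u \<in> R" using c dR Units_RR_closed[OF u] by simp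
  then have cdu: "c \<otimes> d \<otimes> u \<in> I"
    by (rule lead_coeff_in_span[OF _ exponents_add[OF \<alpha> \<beta>] t' prod])
  \<comment> \<open>The unit left over from the product of monomials is removed by its inverse,
    \<open>I\<close> being an ideal.\<close>
  obtain v where v: "v \<in> R" "u \<in> R" "u \<otimes> v = \<one>" using u by (auto simp: Units_RR)
  have "c \<otimes> d = c \<otimes> d \<otimes> u \<otimes> v" using c dR v by (simp add: m_assoc)
  then show ?thesis using RR_idealD(5)[OF I cdu v(1)] by simp
qed

section \<open>From a Sigma-prime ideal I to a prime ideal IA\<close>

lemma prime_if_sigma_prime:
  assumes prime: "sigma_prime_ideal RR (pbw_Sigma A R n x) I"
  shows "nc_prime_ideal A (right_extension A I)"
proof -
  define P where "P = pbw_span I (exponents n)"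
  have inv: "Sigma_ideal I" and ne: "I \<noteq> R"
    using prime by (auto simp: sigma_prime_ideal_def)
  note I = Sigma_idealD(1)[OF inv]
  have P: "ideal P A" unfolding P_def by (rule pbw_span_ideal[OF inv])
  interpret P: ideal P A by (rule P)
  \<comment> \<open>Primeness is tested first on ideals above \<open>P\<close>, since
    \<open>span_of_lead_coeffs\<close> requires \<open>P \<subseteq> J\<close>.\<close>
  have above: "J \<subseteq> P \<or> K \<subseteq> P"
    if J: "ideal J A" "P \<subseteq> J" and K: "ideal K A" "P \<subseteq> K" and JK: "ideal_prod A J K \<subseteq> P" for J K
  proof -
    have inv_lead: "Sigma_ideal (lead_coeffs M)" if "ideal M A" for M
      unfolding Sigma_ideal_iff using lead_coeffs_ideal[OF that] lead_coeffs_sigma[OF that] by blast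
    have "ideal_prod RR (lead_coeffs J) (lead_coeffs K) \<subseteq> I"
    proof
      fix a assume "a \<in> ideal_prod RR (lead_coeffs J) (lead_coeffs K)"
      then show "a \<in> I"
      proof (induction a rule: ideal_prod.induct)
        case (prod c d)
        then show ?case using lead_coeffs_mult[OF J(1) K(1) I JK[unfolded P_def]] by simp
      next
        case (sum c d)
        then show ?case using RR_idealD(3)[OF I] by simp
      qed
    qed
    then have "lead_coeffs J \<subseteq> I \<or> lead_coeffs K \<subseteq> I"
      using prime inv_lead[OF J(1)] inv_lead[OF K(1)] unfolding sigma_prime_ideal_def by blast
    then show ?thesis
      using span_of_lead_coeffs[OF _ I] J K unfolding P_def by blast
  qed
  have "J \<subseteq> P \<or> K \<subseteq> P"
    if J: "ideal J A" and K: "ideal K A" and JK: "ideal_prod A J K \<subseteq> P" for J K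
  proof -
    interpret J: ideal J A by (rule J)
    interpret K: ideal K A by (rule K)
    have zero: "\<zero> \<in> M" if "ideal M A" for M
      using additive_subgroup.zero_closed[OF ideal.axioms(1)[OF that]] .
    have sup: "M \<subseteq> set_add A M P" "P \<subseteq> set_add A M P" if M: "ideal M A" for M
    proof -
      have carr: "m \<in> carrier A" if "m \<in> M" for m using ideal.Icarr[OF M that] .
      show "M \<subseteq> set_add A M P"
        unfolding set_add_def' using carr zero[OF P] by (auto intro!: bexI[of _ \<zero>])
      show "P \<subseteq> set_add A M P"
        unfolding set_add_def' using P.Icarr zero[OF M] by (auto intro!: bexI[of _ \<zero>])
    qed
    \<comment> \<open>The general case is reduced to ideals above \<open>P\<close> by adding
      \<open>P\<close> to both: every mixed product falls into \<open>P\<close>.\<close>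
    have "ideal_prod A (set_add A J P) (set_add A K P) \<subseteq> P"
    proof
      fix a assume "a \<in> ideal_prod A (set_add A J P) (set_add A K P)"
      then show "a \<in> P"
      proof (induction a rule: ideal_prod.induct)
        case (prod a b)
        then obtain j p k q where j: "j \<in> J" "p \<in> P" "a = j \<oplus> p" and k: "k \<in> K" "q \<in> P" "b = k \<oplus> q"
          unfolding set_add_def' by blast
        have cl: "j \<in> carrier A" "p \<in> carrier A" "k \<in> carrier A" "q \<in> carrier A"
          using j k J.Icarr K.Icarr P.Icarr by auto
        have "a \<otimes> b = j \<otimes> k \<oplus> (j \<otimes> q \<oplus> p \<otimes> (k \<oplus> q))"
          unfolding j(3) k(3) using cl by (simp add: l_distr r_distr a_ac)
        moreover have "j \<otimes> k \<in> P" using ideal_prod.prod[OF j(1) k(1), of A] JK by blast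
        moreover have "j \<otimes> q \<in> P" "p \<otimes> (k \<oplus> q) \<in> P"
          using P.I_l_closed[OF k(2) cl(1)] P.I_r_closed[OF j(2)] cl by auto
        ultimately show ?case
          using additive_subgroup.a_closed[OF P.additive_subgroup_axioms] by metis
      next
        case (sum a b)
        then show ?case using additive_subgroup.a_closed[OF P.additive_subgroup_axioms] by blast
      qed
    qed
    then have "set_add A J P \<subseteq> P \<or> set_add A K P \<subseteq> P"
      by (rule above[OF add_ideals[OF J P] sup(2)[OF J] add_ideals[OF K P] sup(2)[OF K]])
    then show ?thesis using sup(1)[OF J] sup(1)[OF K] by blast
  qed
  moreover have "P \<noteq> carrier A"
  proof
    assume "P = carrier A"
    then have "right_extension A I = carrier A" unfolding right_extension_eq[OF inv] P_def .
    then have "R \<subseteq> I" using right_extension_Int[OF inv] R_closed by blast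
    then show False using ne RR_idealD(1)[OF I] by blast
  qed
  ultimately show ?thesis
    unfolding nc_prime_ideal_def right_extension_eq[OF inv] P_def[symmetric] using P by blast
qed

end

theorem theorem4p5:
  fixes A :: "('a, 'b) ring_scheme" and R I :: "'a set" and n :: nat and x :: "nat \<Rightarrow> 'a"
  assumes "skew_PBW_extension A R n x"
    and "cring (A\<lparr>carrier := R\<rparr>)"
    and "noetherian_ring (A\<lparr>carrier := R\<rparr>)"
    and "pbw_bijective A R n x"
    and "pbw_automorphism_type A R n x"
    and "invariant_ideal (A\<lparr>carrier := R\<rparr>) (pbw_Sigma A R n x) I"
    and "I \<noteq> R"
  shows "(sigma_prime_ideal (A\<lparr>carrier := R\<rparr>) (pbw_Sigma A R n x) I \<longleftrightarrow>
            nc_prime_ideal A (right_extension A I))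
       \<and> (sigma_prime_ideal (A\<lparr>carrier := R\<rparr>) (pbw_Sigma A R n x) I \<longrightarrow>
            right_extension A I = left_extension A I \<and> right_extension A I \<inter> R = I)"
proof -
  interpret noetherian_aut_skew_PBW_extension A R n x
    using assms by (simp add: noetherian_aut_skew_PBW_extension_def
        noetherian_aut_skew_PBW_extension_axioms_def bijective_aut_skew_PBW_extension_def
        bijective_aut_skew_PBW_extension_axioms_def)
  note inv = assms(6)
  \<comment> \<open>By the Noetherian hypothesis each \<open>\<sigma> i\<close> maps
    \<open>I\<close> onto itself, so \<open>AI\<close> has the same description by coefficients as
    \<open>IA\<close>.\<close>
  have "\<forall>i\<in>{1..n}. \<sigma> i ` I = I"
    using sigma_image_ideal Sigma_idealD[OF inv] by blast
  then have "right_extension A I = left_extension A I"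
    using left_extension_eq[OF Sigma_idealD(1)[OF inv]] by (simp add: right_extension_eq[OF inv])
  then show ?thesis
    using prime_if_sigma_prime sigma_prime_if_prime[OF inv] right_extension_Int[OF inv] by blast
qed

end
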